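(* (i) Let $H$ be a Hilbert space and $S$ an isometry on $H$. Then there exist a Hilbert space $\hat H$ containing $H$ and a unitary operator $\hat S$ on $\hat H$ such that $$\hat S|_H=S,\qquad \overline{\bigcup_{n\geq 0}\hat S^{-n}H}=\hat H.$$ Moreover, these are unique up to an intertwining isomorphism: if $(\hat H',\hat S')$ is another such pair, there is a unitary $W\colon\hat H\to\hat H'$ which is the identity on $H$ and satisfies $W\hat S=\hat S'W$. (ii) Let $H$, $S$, $\hat H$, $\hat S$ be as in (i). If $\mathcal{A}$ is a $C^*$-algebra, $\alpha$ is an endomorphism of $\mathcal{A}$, and $\pi$ is a representation of $\mathcal{A}$ on $H$ such that $$S\pi(g)=\pi(\alpha(g))S,\qquad g\in\mathcal{A},$$ then there exists a unique representation $\hat\pi$ of $\mathcal{A}$ on $\hat H$ such that $$\hat\pi(g)|_H=\pi(g),\qquad \hat S\hat\pi(g)=\hat\pi(\alpha(g))\hat S,\qquad g\in\mathcal{A}.$$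
   Context: An endomorphism of a $C^*$-algebra is a $*$-homomorphism from the algebra to itself. A representation is a $*$-homomorphism into the bounded operators on a Hilbert space. "Containing $H$" means that $H$ is (identified with) a closed subspace of $\hat H$. *)

theory Defs
  imports "HOL-Analysis.Analysis" "HOL-Algebra.Algebraic_Closure_Type"
begin

section \<open>Hilbert spaces\<close>

text \<open>
  Hilbert spaces have explicit carriers, because the existence of a Hilbert space depending on a
  given one has to be asserted. A space is a module in the sense of \<open>HOL-Algebra\<close> over the field of
  complex numbers, with an inner product that is linear in the first argument. The
  fields \<open>mult\<close> and \<open>one\<close>, inherited from the record type of rings, play no role.
\<close>

record 'a inner_space = "(complex, 'a) module" +
  ip :: "'a \<Rightarrow> 'a \<Rightarrow> complex"

definition ip_norm :: "'a inner_space \<Rightarrow> 'a \<Rightarrow> real" where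
  "ip_norm V x = sqrt (Re (ip V x x))"

text \<open>\<open>Metric_space\<close> demands nonnegativity and symmetry on the whole type, hence the value 0
  outside the carrier.\<close>

definition ip_dist :: "'a inner_space \<Rightarrow> 'a \<Rightarrow> 'a \<Rightarrow> real" where
  "ip_dist V x y =
    (if x \<in> carrier V \<and> y \<in> carrier V then ip_norm V (x \<ominus>\<^bsub>V\<^esub> y) else 0)"

locale complex_inner_space = module "ring_of_type_algebra :: complex ring" V
  for V :: "'a inner_space" (structure) +
  assumes ip_add_left:
      "\<lbrakk>x \<in> carrier V; y \<in> carrier V; z \<in> carrier V\<rbrakk>
        \<Longrightarrow> ip V (x \<oplus>\<^bsub>V\<^esub> y) z = ip V x z + ip V y z"
    and ip_smult_left:
      "\<lbrakk>x \<in> carrier V; y \<in> carrier V\<rbrakk> \<Longrightarrow> ip V (c \<odot>\<^bsub>V\<^esub> x) y = c * ip V x y"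
    and ip_commute:
      "\<lbrakk>x \<in> carrier V; y \<in> carrier V\<rbrakk> \<Longrightarrow> ip V y x = cnj (ip V x y)"
    and ip_pos:
      "\<lbrakk>x \<in> carrier V; x \<noteq> \<zero>\<^bsub>V\<^esub>\<rbrakk> \<Longrightarrow> 0 < Re (ip V x x)"
begin

lemma ip_zero_left:
  assumes "y \<in> carrier V"
  shows "ip V \<zero>\<^bsub>V\<^esub> y = 0"
  using ip_add_left[of "\<zero>\<^bsub>V\<^esub>" "\<zero>\<^bsub>V\<^esub>" y] assms by simp

lemma ip_add_right:
  assumes "x \<in> carrier V" "y \<in> carrier V" "z \<in> carrier V"
  shows "ip V z (x \<oplus>\<^bsub>V\<^esub> y) = ip V z x + ip V z y"
  using assms ip_add_left[of x y z] ip_commute[of "x \<oplus>\<^bsub>V\<^esub> y" z] ip_commute[of x z]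
    ip_commute[of y z] by simp

lemma smult_carrier: "x \<in> carrier V \<Longrightarrow> c \<odot>\<^bsub>V\<^esub> x \<in> carrier V"
  using smult_closed[of c x] by (simp add: ring_of_type_algebra_def)

lemma ip_smult_right:
  assumes "x \<in> carrier V" "y \<in> carrier V"
  shows "ip V y (c \<odot>\<^bsub>V\<^esub> x) = cnj c * ip V y x"
  using assms ip_smult_left[of x y c] ip_commute[of "c \<odot>\<^bsub>V\<^esub> x" y] ip_commute[of x y]
    smult_carrier by simp

lemma ip_ge_0: "x \<in> carrier V \<Longrightarrow> 0 \<le> Re (ip V x x)"
  using ip_pos[of x] ip_zero_left[of "\<zero>\<^bsub>V\<^esub>"] by (cases "x = \<zero>\<^bsub>V\<^esub>") auto

lemma ip_minus_left:
  assumes "x \<in> carrier V" "y \<in> carrier V"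
  shows "ip V (\<ominus>\<^bsub>V\<^esub> x) y = - ip V x y"
proof -
  have "ip V (x \<oplus>\<^bsub>V\<^esub> \<ominus>\<^bsub>V\<^esub> x) y = 0"
    using assms ip_zero_left by (simp add: M.r_neg)
  then show ?thesis
    using assms ip_add_left[of x "\<ominus>\<^bsub>V\<^esub> x" y] by (simp add: add_eq_0_iff)
qed

lemma ip_minus_right:
  assumes "x \<in> carrier V" "y \<in> carrier V"
  shows "ip V y (\<ominus>\<^bsub>V\<^esub> x) = - ip V y x"
  using assms ip_minus_left[of x y] ip_commute[of "\<ominus>\<^bsub>V\<^esub> x" y] ip_commute[of x y] by simp

lemma ip_norm_square: "x \<in> carrier V \<Longrightarrow> (ip_norm V x)\<^sup>2 = Re (ip V x x)"
  by (simp add: ip_norm_def ip_ge_0)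

lemma Re_ip_le:
  assumes x: "x \<in> carrier V" and y: "y \<in> carrier V"
  shows "Re (ip V x y) \<le> ip_norm V x * ip_norm V y"
proof -
  define a b r where "a = Re (ip V x x)" and "b = Re (ip V y y)" and "r = Re (ip V x y)"
  have b0: "0 \<le> b" using y ip_ge_0 by (simp add: b_def)
  have q: "0 \<le> a + 2 * t * r + t\<^sup>2 * b" for t :: real
  proof -
    have "0 \<le> Re (ip V (x \<oplus>\<^bsub>V\<^esub> complex_of_real t \<odot>\<^bsub>V\<^esub> y) (x \<oplus>\<^bsub>V\<^esub> complex_of_real t \<odot>\<^bsub>V\<^esub> y))"
      using x y smult_carrier ip_ge_0 by simp
    also have "\<dots> = a + 2 * t * r + t\<^sup>2 * b"
      using x y smult_carrier ip_commute[of x y]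
      by (simp add: ip_add_left ip_add_right ip_smult_left ip_smult_right a_def b_def r_def
          power2_eq_square algebra_simps)
    finally show ?thesis .
  qed
  have "r\<^sup>2 \<le> a * b"
  proof (cases "b = 0")
    case True
    have "y = \<zero>\<^bsub>V\<^esub>" using True ip_pos[of y] y by (auto simp: b_def)
    then have "r = 0" using x ip_zero_left[of x] ip_commute[of y x] y by (simp add: r_def)
    then show ?thesis using True by simp
  next
    case False
    then have bp: "0 < b" using b0 by simp
    have "a + 2 * (- r / b) * r + (- r / b)\<^sup>2 * b = a - r\<^sup>2 / b"
      using bp by (simp add: field_simps power2_eq_square)
    then have "r\<^sup>2 / b \<le> a" using q[of "- r / b"] by simp
    then show ?thesis using bp by (simp add: field_simps)
  qed
  then have "\<bar>r\<bar> \<le> sqrt (a * b)" using real_le_rsqrt[of "\<bar>r\<bar>"] by simp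
  then show ?thesis by (simp add: ip_norm_def a_def b_def r_def real_sqrt_mult)
qed

lemma ip_norm_triangle:
  assumes x: "x \<in> carrier V" and y: "y \<in> carrier V"
  shows "ip_norm V (x \<oplus>\<^bsub>V\<^esub> y) \<le> ip_norm V x + ip_norm V y"
proof (rule power2_le_imp_le)
  have "(ip_norm V (x \<oplus>\<^bsub>V\<^esub> y))\<^sup>2 = Re (ip V x x) + Re (ip V y y) + 2 * Re (ip V x y)"
    using x y ip_commute[of x y] by (simp add: ip_norm_square ip_add_left ip_add_right)
  also have "\<dots> \<le> (ip_norm V x + ip_norm V y)\<^sup>2"
    using x y Re_ip_le[OF x y] by (simp add: ip_norm_square power2_sum)
  finally show "(ip_norm V (x \<oplus>\<^bsub>V\<^esub> y))\<^sup>2 \<le> (ip_norm V x + ip_norm V y)\<^sup>2" .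
  show "0 \<le> ip_norm V x + ip_norm V y" using x y by (simp add: ip_norm_def ip_ge_0)
qed

sublocale Metric_space "carrier V" "ip_dist V"
proof
  show "0 \<le> ip_dist V x y" for x y by (simp add: ip_dist_def ip_norm_def ip_ge_0)
  show "ip_dist V x y = ip_dist V y x" for x y
  proof (cases "x \<in> carrier V \<and> y \<in> carrier V")
    case True
    then have "ip V (x \<ominus>\<^bsub>V\<^esub> y) (x \<ominus>\<^bsub>V\<^esub> y) = ip V (y \<ominus>\<^bsub>V\<^esub> x) (y \<ominus>\<^bsub>V\<^esub> x)"
      by (simp add: a_minus_def ip_add_left ip_add_right ip_minus_left ip_minus_right)
    then show ?thesis by (simp add: ip_dist_def ip_norm_def)
  qed (auto simp: ip_dist_def)
  show "ip_dist V x y = 0 \<longleftrightarrow> x = y" if "x \<in> carrier V" "y \<in> carrier V" for x y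
  proof
    assume "ip_dist V x y = 0"
    then have "x \<ominus>\<^bsub>V\<^esub> y = \<zero>\<^bsub>V\<^esub>"
      using that ip_pos[of "x \<ominus>\<^bsub>V\<^esub> y"] by (auto simp: ip_dist_def ip_norm_def)
    then show "x = y"
      using that M.minus_equality[of x "\<ominus>\<^bsub>V\<^esub> y"] by (simp add: a_minus_def)
  next
    assume "x = y"
    then show "ip_dist V x y = 0"
      using that ip_zero_left[of "\<zero>\<^bsub>V\<^esub>"]
      by (simp add: ip_dist_def ip_norm_def a_minus_def M.r_neg)
  qed
  show "ip_dist V x z \<le> ip_dist V x y + ip_dist V y z"
    if "x \<in> carrier V" "y \<in> carrier V" "z \<in> carrier V" for x y z
  proof -
    have "(x \<ominus>\<^bsub>V\<^esub> y) \<oplus>\<^bsub>V\<^esub> (y \<ominus>\<^bsub>V\<^esub> z) = x \<oplus>\<^bsub>V\<^esub> ((\<ominus>\<^bsub>V\<^esub> y \<oplus>\<^bsub>V\<^esub> y) \<oplus>\<^bsub>V\<^esub> \<ominus>\<^bsub>V\<^esub> z)"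
      using that by (simp add: a_minus_def M.a_assoc del: M.l_neg)
    also have "\<dots> = x \<ominus>\<^bsub>V\<^esub> z"
      using that by (simp add: a_minus_def M.l_neg)
    finally show ?thesis
      using that ip_norm_triangle[of "x \<ominus>\<^bsub>V\<^esub> y" "y \<ominus>\<^bsub>V\<^esub> z"] by (simp add: ip_dist_def)
  qed
qed

end

locale complex_hilbert_space = complex_inner_space +
  assumes complete: "mcomplete"

abbreviation ip_topology :: "'a inner_space \<Rightarrow> 'a topology" where
  "ip_topology V \<equiv> Metric_space.mtopology (carrier V) (ip_dist V)"


section \<open>Operators\<close>

text \<open>Operators are functions on the carrier, i.e. extensional, so that equality of operators is
  equality in HOL.\<close>

definition linear_maps :: "'a inner_space \<Rightarrow> 'b inner_space \<Rightarrow> ('a \<Rightarrow> 'b) set" where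
  "linear_maps V W = {T \<in> carrier V \<rightarrow>\<^sub>E carrier W.
    (\<forall>x\<in>carrier V. \<forall>y\<in>carrier V. T (x \<oplus>\<^bsub>V\<^esub> y) = T x \<oplus>\<^bsub>W\<^esub> T y) \<and>
    (\<forall>c. \<forall>x\<in>carrier V. T (c \<odot>\<^bsub>V\<^esub> x) = c \<odot>\<^bsub>W\<^esub> T x)}"

definition bounded_operators :: "'a inner_space \<Rightarrow> ('a \<Rightarrow> 'a) set" where
  "bounded_operators V = {T \<in> linear_maps V V.
    \<exists>b. \<forall>x\<in>carrier V. ip_norm V (T x) \<le> b * ip_norm V x}"

definition is_adjoint :: "'a inner_space \<Rightarrow> ('a \<Rightarrow> 'a) \<Rightarrow> ('a \<Rightarrow> 'a) \<Rightarrow> bool" where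
  "is_adjoint V T T' \<longleftrightarrow> (\<forall>x\<in>carrier V. \<forall>y\<in>carrier V. ip V (T x) y = ip V x (T' y))"

definition isometry :: "'a inner_space \<Rightarrow> ('a \<Rightarrow> 'a) \<Rightarrow> bool" where
  "isometry V T \<longleftrightarrow> T \<in> linear_maps V V \<and> (\<forall>x\<in>carrier V. ip_norm V (T x) = ip_norm V x)"

definition unitary :: "'a inner_space \<Rightarrow> 'b inner_space \<Rightarrow> ('a \<Rightarrow> 'b) \<Rightarrow> bool" where
  "unitary V W T \<longleftrightarrow> T \<in> linear_maps V W \<and> T ` carrier V = carrier W \<and>
    (\<forall>x\<in>carrier V. \<forall>y\<in>carrier V. ip W (T x) (T y) = ip V x y)"

text \<open>\<open>J\<close> identifies \<open>H\<close> with a closed subspace of \<open>K\<close>.\<close>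

definition closed_embedding :: "'a inner_space \<Rightarrow> 'b inner_space \<Rightarrow> ('a \<Rightarrow> 'b) \<Rightarrow> bool" where
  "closed_embedding H K J \<longleftrightarrow> J \<in> linear_maps H K \<and>
    (\<forall>x\<in>carrier H. \<forall>y\<in>carrier H. ip K (J x) (J y) = ip H x y) \<and>
    closedin (ip_topology K) (J ` carrier H)"

text \<open>The condition on the closure makes the map sending \<open>x\<close> to the sequence of
  vectors \<open>J\<^sup>* (U ^^ n) x\<close> injective on \<open>K\<close>, so up to isomorphism every such \<open>K\<close> over the
  type \<open>'a\<close> has its carrier in the type \<open>nat \<Rightarrow> 'a\<close>.\<close>

definition minimal_unitary_extension ::
  "'a inner_space \<Rightarrow> ('a \<Rightarrow> 'a) \<Rightarrow> 'b inner_space \<Rightarrow> ('a \<Rightarrow> 'b) \<Rightarrow> ('b \<Rightarrow> 'b) \<Rightarrow> bool" where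
  "minimal_unitary_extension H S K J U \<longleftrightarrow>
    complex_hilbert_space K \<and> closed_embedding H K J \<and> unitary K K U \<and>
    (\<forall>x\<in>carrier H. U (J x) = J (S x)) \<and>
    ip_topology K closure_of (\<Union>n. (inv_into (carrier K) U ^^ n) ` J ` carrier H) = carrier K"


section \<open>C*-algebras and representations\<close>

text \<open>No unit is required.\<close>

class cstar_algebra = real_normed_algebra + banach +
  fixes scaleC :: "complex \<Rightarrow> 'a \<Rightarrow> 'a" (infixr \<open>*\<^sub>C\<close> 75)
    and star :: "'a \<Rightarrow> 'a"
  assumes scaleC_add_right: "c *\<^sub>C (x + y) = c *\<^sub>C x + c *\<^sub>C y"
    and scaleC_add_left: "(c + d) *\<^sub>C x = c *\<^sub>C x + d *\<^sub>C x"
    and scaleC_scaleC: "c *\<^sub>C d *\<^sub>C x = (c * d) *\<^sub>C x"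
    and scaleC_of_real: "complex_of_real r *\<^sub>C x = r *\<^sub>R x"
    and norm_scaleC: "norm (c *\<^sub>C x) = cmod c * norm x"
    and mult_scaleC_left: "(c *\<^sub>C x) * y = c *\<^sub>C (x * y)"
    and mult_scaleC_right: "x * (c *\<^sub>C y) = c *\<^sub>C (x * y)"
    and star_star: "star (star x) = x"
    and star_add: "star (x + y) = star x + star y"
    and star_scaleC: "star (c *\<^sub>C x) = cnj c *\<^sub>C star x"
    and star_mult: "star (x * y) = star y * star x"
    and cstar_identity: "norm (star x * x) = (norm x)\<^sup>2"

definition cstar_endomorphism :: "('g::cstar_algebra \<Rightarrow> 'g) \<Rightarrow> bool" where
  "cstar_endomorphism \<alpha> \<longleftrightarrow>
    (\<forall>a b. \<alpha> (a + b) = \<alpha> a + \<alpha> b) \<and> (\<forall>c a. \<alpha> (c *\<^sub>C a) = c *\<^sub>C \<alpha> a) \<and>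
    (\<forall>a b. \<alpha> (a * b) = \<alpha> a * \<alpha> b) \<and> (\<forall>a. \<alpha> (star a) = star (\<alpha> a))"

definition star_representation :: "'a inner_space \<Rightarrow> ('g::cstar_algebra \<Rightarrow> 'a \<Rightarrow> 'a) \<Rightarrow> bool" where
  "star_representation V \<pi> \<longleftrightarrow>
    (\<forall>a. \<pi> a \<in> bounded_operators V) \<and>
    (\<forall>a b. \<forall>x\<in>carrier V. \<pi> (a + b) x = \<pi> a x \<oplus>\<^bsub>V\<^esub> \<pi> b x) \<and>
    (\<forall>c a. \<forall>x\<in>carrier V. \<pi> (c *\<^sub>C a) x = c \<odot>\<^bsub>V\<^esub> \<pi> a x) \<and>
    (\<forall>a b. \<forall>x\<in>carrier V. \<pi> (a * b) x = \<pi> a (\<pi> b x)) \<and>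
    (\<forall>a. is_adjoint V (\<pi> a) (\<pi> (star a)))"

end

theory Submission
  imports Defs
begin

text \<open>
  A vector \<open>x\<close> of the extension \<open>K\<close> is determined by the sequence of the orthogonal
  projections of \<open>U\<^sup>n x\<close> to \<open>H\<close>, consecutive terms of which are related by \<open>S\<^sup>*\<close>.
  Conversely, the bounded sequences \<open>f\<close> in \<open>H\<close> with \<open>S\<^sup>* (f (n + 1)) = f n\<close> form a
  Hilbert space under the limit of the inner products, on which the shift is unitary and extends
  \<open>S\<close>.

  The remaining claims come from one universal property: \<open>K\<close> is the closure of the increasing
  union of the \<open>U\<^sup>-\<^sup>n H\<close>, so a uniformly bounded compatible family of linear maps on these
  subspaces extends uniquely to \<open>K\<close>. The maps \<open>U\<^sup>-\<^sup>n h \<mapsto> U'\<^sup>-\<^sup>n h\<close> give uniqueness, and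
  \<open>U\<^sup>-\<^sup>n h \<mapsto> U\<^sup>-\<^sup>n \<pi> (\<alpha>\<^sup>n g) h\<close> give the representation; the latter are bounded by
  \<open>\<parallel>g\<parallel>\<close> for all \<open>n\<close> because the representations \<open>\<pi> \<circ> \<alpha>\<^sup>n\<close> are contractive.
\<close>

section \<open>Inner product spaces\<close>

context complex_inner_space
begin

lemma smult_simps [simp]:
  assumes "x \<in> carrier V"
  shows "c \<odot>\<^bsub>V\<^esub> x \<in> carrier V" "1 \<odot>\<^bsub>V\<^esub> x = x" "0 \<odot>\<^bsub>V\<^esub> x = \<zero>\<^bsub>V\<^esub>"
    "c \<odot>\<^bsub>V\<^esub> (d \<odot>\<^bsub>V\<^esub> x) = (c * d) \<odot>\<^bsub>V\<^esub> x"
  using assms smult_carrier smult_one[of x] smult_l_null[of x] smult_assoc1[of c d x]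
  by (simp_all add: ring_of_type_algebra_def)

lemma smult_add_right:
  "\<lbrakk>x \<in> carrier V; y \<in> carrier V\<rbrakk> \<Longrightarrow> c \<odot>\<^bsub>V\<^esub> (x \<oplus>\<^bsub>V\<^esub> y) = c \<odot>\<^bsub>V\<^esub> x \<oplus>\<^bsub>V\<^esub> c \<odot>\<^bsub>V\<^esub> y"
  using smult_r_distr[of c x y] by (simp add: ring_of_type_algebra_def)

lemma smult_add_left:
  "x \<in> carrier V \<Longrightarrow> (c + d) \<odot>\<^bsub>V\<^esub> x = c \<odot>\<^bsub>V\<^esub> x \<oplus>\<^bsub>V\<^esub> d \<odot>\<^bsub>V\<^esub> x"
  using smult_l_distr[of c d x] by (simp add: ring_of_type_algebra_def)

lemma smult_zero_right [simp]: "c \<odot>\<^bsub>V\<^esub> \<zero>\<^bsub>V\<^esub> = \<zero>\<^bsub>V\<^esub>"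
  using smult_r_null[of c] by (simp add: ring_of_type_algebra_def)

lemma minus_eq_smult: "x \<in> carrier V \<Longrightarrow> \<ominus>\<^bsub>V\<^esub> x = (-1) \<odot>\<^bsub>V\<^esub> x"
  using smult_add_left[of x "-1" 1] by (simp add: M.minus_equality)

lemma diff_eq_smult: "y \<in> carrier V \<Longrightarrow> x \<ominus>\<^bsub>V\<^esub> y = x \<oplus>\<^bsub>V\<^esub> (-1) \<odot>\<^bsub>V\<^esub> y"
  by (simp add: a_minus_def minus_eq_smult)

lemma ip_zero_right: "y \<in> carrier V \<Longrightarrow> ip V y \<zero>\<^bsub>V\<^esub> = 0"
  using ip_commute[of "\<zero>\<^bsub>V\<^esub>" y] ip_zero_left[of y] by simp

lemmas ip_simps = ip_add_left ip_add_right ip_smult_left ip_smult_right ip_zero_left ip_zero_right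
  ip_minus_left ip_minus_right

lemma norm_ge_0 [simp]: "x \<in> carrier V \<Longrightarrow> 0 \<le> ip_norm V x"
  by (simp add: ip_norm_def ip_ge_0)

lemma norm_zero [simp]: "ip_norm V \<zero>\<^bsub>V\<^esub> = 0"
  by (simp add: ip_norm_def ip_zero_left)

lemma ip_self: "x \<in> carrier V \<Longrightarrow> ip V x x = of_real ((ip_norm V x)\<^sup>2)"
  using ip_commute[of x x] by (simp add: complex_eq_iff ip_norm_square)

lemma norm_smult: "x \<in> carrier V \<Longrightarrow> ip_norm V (c \<odot>\<^bsub>V\<^esub> x) = cmod c * ip_norm V x"
proof -
  assume x: "x \<in> carrier V"
  have "ip V (c \<odot>\<^bsub>V\<^esub> x) (c \<odot>\<^bsub>V\<^esub> x) = of_real ((cmod c)\<^sup>2) * of_real ((ip_norm V x)\<^sup>2)"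
    using x ip_self[OF x] by (simp add: ip_simps mult_ac flip: complex_norm_square)
  then have "(ip_norm V (c \<odot>\<^bsub>V\<^esub> x))\<^sup>2 = (cmod c * ip_norm V x)\<^sup>2"
    using x by (simp add: ip_norm_square power_mult_distrib flip: of_real_mult of_real_power)
  then show ?thesis using x by (simp add: power2_eq_iff_nonneg)
qed

lemma norm_minus: "x \<in> carrier V \<Longrightarrow> ip_norm V (\<ominus>\<^bsub>V\<^esub> x) = ip_norm V x"
  by (simp add: minus_eq_smult norm_smult)

text \<open>Cauchy-Schwarz for the modulus follows from the bound on the real part after multiplying
  \<open>x\<close> by the unimodular \<open>c\<close> that makes the inner product real and
  nonnegative.\<close>

lemma norm_ip_le:
  assumes x: "x \<in> carrier V" and y: "y \<in> carrier V"
  shows "cmod (ip V x y) \<le> ip_norm V x * ip_norm V y"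
proof (cases "ip V x y = 0")
  case False
  define c where "c = cnj (sgn (ip V x y))"
  have "ip V (c \<odot>\<^bsub>V\<^esub> x) y = of_real (cmod (ip V x y))"
    using x y False complex_norm_square[of "ip V x y"]
    by (simp add: ip_smult_left c_def sgn_eq field_simps power2_eq_square)
  moreover have "cmod c = 1" using False by (simp add: c_def norm_sgn)
  ultimately show ?thesis using Re_ip_le[of "c \<odot>\<^bsub>V\<^esub> x" y] x y by (simp add: norm_smult)
qed (use x y in simp)

lemma norm_add_square:
  "\<lbrakk>x \<in> carrier V; y \<in> carrier V\<rbrakk> \<Longrightarrow>
    (ip_norm V (x \<oplus>\<^bsub>V\<^esub> y))\<^sup>2 = (ip_norm V x)\<^sup>2 + (ip_norm V y)\<^sup>2 + 2 * Re (ip V x y)"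
  using ip_commute[of x y] by (simp add: ip_norm_square ip_simps)

text \<open>Polarization: together with \<open>Im_ip_polar\<close> it expresses inner products
  through norms, so preservation or convergence of norms carries over to inner products.\<close>

lemma Re_ip_polar:
  "\<lbrakk>x \<in> carrier V; y \<in> carrier V\<rbrakk> \<Longrightarrow>
    Re (ip V x y) = ((ip_norm V (x \<oplus>\<^bsub>V\<^esub> y))\<^sup>2 - (ip_norm V x)\<^sup>2 - (ip_norm V y)\<^sup>2) / 2"
  by (simp add: norm_add_square)

lemma Im_ip_polar:
  "\<lbrakk>x \<in> carrier V; y \<in> carrier V\<rbrakk> \<Longrightarrow> Im (ip V x y) = Re (ip V x (\<i> \<odot>\<^bsub>V\<^esub> y))"
  by (simp add: ip_simps)

lemma dist_eq: "\<lbrakk>x \<in> carrier V; y \<in> carrier V\<rbrakk> \<Longrightarrow> ip_dist V x y = ip_norm V (x \<ominus>\<^bsub>V\<^esub> y)"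
  by (simp add: ip_dist_def)

lemma dist_zero [simp]: "x \<in> carrier V \<Longrightarrow> ip_dist V x \<zero>\<^bsub>V\<^esub> = ip_norm V x"
  by (simp add: dist_eq a_minus_def minus_eq_smult)

lemma dist_square:
  "\<lbrakk>x \<in> carrier V; y \<in> carrier V\<rbrakk> \<Longrightarrow>
    (ip_dist V x y)\<^sup>2 = (ip_norm V x)\<^sup>2 + (ip_norm V y)\<^sup>2 - 2 * Re (ip V x y)"
  by (simp add: dist_eq a_minus_def norm_add_square norm_minus ip_simps)

lemma dist_add_le:
  assumes "x \<in> carrier V" "y \<in> carrier V" "x' \<in> carrier V" "y' \<in> carrier V"
  shows "ip_dist V (x \<oplus>\<^bsub>V\<^esub> x') (y \<oplus>\<^bsub>V\<^esub> y') \<le> ip_dist V x y + ip_dist V x' y'"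
proof -
  have "(x \<oplus>\<^bsub>V\<^esub> x') \<ominus>\<^bsub>V\<^esub> (y \<oplus>\<^bsub>V\<^esub> y') = (x \<ominus>\<^bsub>V\<^esub> y) \<oplus>\<^bsub>V\<^esub> (x' \<ominus>\<^bsub>V\<^esub> y')"
    using assms by (simp add: a_minus_def M.minus_add M.a_ac)
  then show ?thesis using assms by (simp add: dist_eq ip_norm_triangle)
qed

lemma dist_smult:
  assumes "x \<in> carrier V" "y \<in> carrier V"
  shows "ip_dist V (c \<odot>\<^bsub>V\<^esub> x) (c \<odot>\<^bsub>V\<^esub> y) = cmod c * ip_dist V x y"
proof -
  have "(c \<odot>\<^bsub>V\<^esub> x) \<ominus>\<^bsub>V\<^esub> (c \<odot>\<^bsub>V\<^esub> y) = c \<odot>\<^bsub>V\<^esub> (x \<ominus>\<^bsub>V\<^esub> y)"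
    using assms by (simp add: diff_eq_smult smult_add_right)
  then show ?thesis using assms by (simp add: dist_eq norm_smult)
qed

lemma norm_le_dist:
  "\<lbrakk>x \<in> carrier V; y \<in> carrier V\<rbrakk> \<Longrightarrow> \<bar>ip_norm V x - ip_norm V y\<bar> \<le> ip_dist V x y"
  using mdist_reverse_triangle[of x "\<zero>\<^bsub>V\<^esub>" y] commute[of "\<zero>\<^bsub>V\<^esub>" y] by simp

lemma norm_ip_diff_le:
  assumes "x \<in> carrier V" "y \<in> carrier V" "z \<in> carrier V"
  shows "cmod (ip V x z - ip V y z) \<le> ip_dist V x y * ip_norm V z"
    and "cmod (ip V z x - ip V z y) \<le> ip_dist V x y * ip_norm V z"
proof -
  have "ip V (x \<ominus>\<^bsub>V\<^esub> y) z = ip V x z - ip V y z" "ip V z (x \<ominus>\<^bsub>V\<^esub> y) = ip V z x - ip V z y"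
    using assms by (simp_all add: a_minus_def ip_simps)
  then show "cmod (ip V x z - ip V y z) \<le> ip_dist V x y * ip_norm V z"
    and "cmod (ip V z x - ip V z y) \<le> ip_dist V x y * ip_norm V z"
    using norm_ip_le[of "x \<ominus>\<^bsub>V\<^esub> y" z] norm_ip_le[of z "x \<ominus>\<^bsub>V\<^esub> y"] assms
    by (simp_all add: dist_eq mult.commute)
qed

lemma dist_eqI:
  assumes "x \<in> carrier V" "y \<in> carrier V" "\<And>e. 0 < e \<Longrightarrow> ip_dist V x y \<le> e"
  shows "x = y"
  using assms field_le_epsilon[of "ip_dist V x y" 0] by (metis add_0 dual_order.antisym nonneg zero)

end

section \<open>Completeness and the Riesz representation theorem\<close>

context complex_hilbert_space
begin

lemma obtain_limit:
  assumes "\<And>n. f n \<in> carrier V"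
    and "\<And>e. 0 < e \<Longrightarrow> \<exists>N. \<forall>m\<ge>N. \<forall>n\<ge>N. ip_dist V (f m) (f n) < e"
  obtains x where "x \<in> carrier V" "(\<lambda>n. ip_dist V (f n) x) \<longlonglongrightarrow> 0"
proof -
  have "MCauchy f"
    using assms unfolding MCauchy_def by blast
  then obtain x where "limitin mtopology f x sequentially"
    using complete mcomplete_def by blast
  then show ?thesis using that by (simp add: limitin_metric_dist_null) blast
qed

text \<open>The vector representing \<open>\<phi>\<close> minimizes \<open>\<parallel>x\<parallel>\<^sup>2 - 2 Re (\<phi> x)\<close>; by the parallelogram law
  minimizing sequences are Cauchy.\<close>

theorem riesz_representation:
  assumes add: "\<And>x y. \<lbrakk>x \<in> carrier V; y \<in> carrier V\<rbrakk> \<Longrightarrow> \<phi> (x \<oplus>\<^bsub>V\<^esub> y) = \<phi> x + \<phi> y"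
    and scale: "\<And>c x. x \<in> carrier V \<Longrightarrow> \<phi> (c \<odot>\<^bsub>V\<^esub> x) = c * \<phi> x"
    and bound: "\<And>x. x \<in> carrier V \<Longrightarrow> cmod (\<phi> x) \<le> C * ip_norm V x"
  obtains y where "y \<in> carrier V" "\<And>x. x \<in> carrier V \<Longrightarrow> \<phi> x = ip V x y"
proof -
  define q where "q x = (ip_norm V x)\<^sup>2 - 2 * Re (\<phi> x)" for x
  define I where "I = Inf (q ` carrier V)"
  \<comment> \<open>Completing the square in \<open>ip_norm V x - C\<close> bounds \<open>q\<close>
    below, which makes \<open>I\<close> a genuine infimum.\<close>
  have q_ge: "- (C\<^sup>2) \<le> q x" if x: "x \<in> carrier V" for x
  proof -
    have "0 \<le> (ip_norm V x - C)\<^sup>2" by simp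
    also have "\<dots> = (ip_norm V x)\<^sup>2 - 2 * (C * ip_norm V x) + C\<^sup>2"
      by (simp add: power2_diff)
    finally show ?thesis
      using bound[OF x] complex_Re_le_cmod[of "\<phi> x"] by (simp add: q_def)
  qed
  have bdd: "bdd_below (q ` carrier V)" using q_ge by (auto intro!: bdd_belowI2)
  have I_le: "I \<le> q x" if "x \<in> carrier V" for x
    unfolding I_def using that bdd by (simp add: cInf_lower)
  have "\<exists>x. x \<in> carrier V \<and> q x < I + inverse (Suc n)" for n
    using cInf_lessD[of "q ` carrier V" "I + inverse (Suc n)"] M.zero_closed by (auto simp: I_def)
  then obtain f where f: "\<And>n. f n \<in> carrier V" and fq: "\<And>n. q (f n) < I + inverse (Suc n)"
    by metis
  have par: "(ip_dist V x y)\<^sup>2 \<le> 2 * q x + 2 * q y - 4 * I"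
    if x: "x \<in> carrier V" and y: "y \<in> carrier V" for x y
  proof -
    \<comment> \<open>The midpoint of \<open>x\<close> and \<open>y\<close> enters the parallelogram
      law, and its value under \<open>q\<close> is at least \<open>I\<close>.\<close>
    have "q ((1/2) \<odot>\<^bsub>V\<^esub> (x \<oplus>\<^bsub>V\<^esub> y)) = (ip_norm V (x \<oplus>\<^bsub>V\<^esub> y))\<^sup>2 / 4 - Re (\<phi> x) - Re (\<phi> y)"
      using x y by (simp add: q_def norm_smult add scale power_divide)
    then have "(ip_dist V x y)\<^sup>2 = 2 * q x + 2 * q y - 4 * q ((1/2) \<odot>\<^bsub>V\<^esub> (x \<oplus>\<^bsub>V\<^esub> y))"
      using x y by (simp add: dist_square norm_add_square) (simp add: q_def field_simps)
    then show ?thesis using I_le[of "(1/2) \<odot>\<^bsub>V\<^esub> (x \<oplus>\<^bsub>V\<^esub> y)"] x y by simp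
  qed
  have cau: "\<exists>N. \<forall>m\<ge>N. \<forall>n\<ge>N. ip_dist V (f m) (f n) < e" if e: "0 < e" for e
  proof -
    obtain N where N: "inverse (real (Suc N)) < e\<^sup>2 / 4"
      using reals_Archimedean[of "e\<^sup>2 / 4"] e by auto
    have "ip_dist V (f m) (f n) < e" if "m \<ge> N" "n \<ge> N" for m n
    proof -
      have close: "q (f k) < I + e\<^sup>2 / 4" if "k \<ge> N" for k
      proof -
        have "inverse (real (Suc k)) \<le> inverse (real (Suc N))"
          using that by (simp add: field_simps)
        then show ?thesis using fq[of k] N by linarith
      qed
      then have "(ip_dist V (f m) (f n))\<^sup>2 < e\<^sup>2"
        using par[OF f f, of m n] close[OF that(1)] close[OF that(2)] by simp
      then show ?thesis using e by (simp add: power2_less_imp_less)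
    qed
    then show ?thesis by blast
  qed
  obtain y where y: "y \<in> carrier V" and lim: "(\<lambda>n. ip_dist V (f n) y) \<longlonglongrightarrow> 0"
    using obtain_limit[OF f cau] by blast
  have phi_lim: "(\<lambda>n. \<phi> (f n)) \<longlonglongrightarrow> \<phi> y"
  proof -
    have "cmod (\<phi> (f n) - \<phi> y) \<le> C * ip_dist V (f n) y" for n
    proof -
      have "\<phi> (f n \<ominus>\<^bsub>V\<^esub> y) = \<phi> (f n) - \<phi> y"
        using f y by (simp add: diff_eq_smult add scale)
      then show ?thesis using bound[of "f n \<ominus>\<^bsub>V\<^esub> y"] f y by (simp add: dist_eq)
    qed
    then have "(\<lambda>n. \<phi> (f n) - \<phi> y) \<longlonglongrightarrow> 0"
      by (intro tendsto_0_le[OF lim, of _ "C"]) (use f y in \<open>auto simp: abs_mult mult.commute intro!: always_eventually\<close>)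
    then show ?thesis by (simp add: LIM_zero_iff)
  qed
  have norm_lim: "(\<lambda>n. ip_norm V (f n)) \<longlonglongrightarrow> ip_norm V y"
  proof -
    have "(\<lambda>n. ip_norm V (f n) - ip_norm V y) \<longlonglongrightarrow> 0"
      by (intro tendsto_0_le[OF lim, of _ 1]) (use norm_le_dist[OF f y] in auto)
    then show ?thesis by (simp add: LIM_zero_iff)
  qed
  have "(\<lambda>n. q (f n)) \<longlonglongrightarrow> q y"
    unfolding q_def by (intro tendsto_intros phi_lim norm_lim)
  moreover have "(\<lambda>n. I + inverse (Suc n)) \<longlonglongrightarrow> I"
    using LIMSEQ_inverse_real_of_nat_add by simp
  ultimately have "q y \<le> I"
    using fq by (intro LIMSEQ_le[of "\<lambda>n. q (f n)" _ "\<lambda>n. I + inverse (Suc n)"]) (auto intro: less_imp_le)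
  then have min: "q y \<le> q x" if "x \<in> carrier V" for x
    using I_le[OF that] by simp
  have Re: "Re (\<phi> x) = Re (ip V x y)" if x: "x \<in> carrier V" for x
  proof (rule ccontr)
    assume ne: "Re (\<phi> x) \<noteq> Re (ip V x y)"
    define d where "d = Re (\<phi> x) - Re (ip V x y)"
    \<comment> \<open>Minimality of \<open>q\<close> at \<open>y\<close>, tested along the real line
      through \<open>y\<close> in direction \<open>x\<close>: the term linear in \<open>t\<close> is
      dominated by the quadratic one.\<close>
    have key: "2 * t * d \<le> t\<^sup>2 * (ip_norm V x)\<^sup>2" for t
    proof -
      have "q (y \<oplus>\<^bsub>V\<^esub> of_real t \<odot>\<^bsub>V\<^esub> x) = q y + t\<^sup>2 * (ip_norm V x)\<^sup>2 - 2 * t * d"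
        using x y ip_commute[of x y]
        by (simp add: q_def d_def norm_add_square norm_smult add scale ip_simps algebra_simps
            power_mult_distrib)
      then show ?thesis using min[of "y \<oplus>\<^bsub>V\<^esub> of_real t \<odot>\<^bsub>V\<^esub> x"] x y by simp
    qed
    \<comment> \<open>The summand 1 keeps \<open>s\<close> positive when \<open>x\<close> is zero.
      With \<open>t = d / s\<close> the inequality \<open>key\<close> forces
      \<open>d = 0\<close>.\<close>
    define s where "s = (ip_norm V x)\<^sup>2 + 1"
    have s: "0 < s" by (simp add: s_def add_nonneg_pos)
    have "2 * (d / s) * d \<le> (d / s)\<^sup>2 * (ip_norm V x)\<^sup>2" by (rule key)
    also have "\<dots> \<le> (d / s)\<^sup>2 * s" by (simp add: s_def mult_left_mono)
    also have "\<dots> = d\<^sup>2 / s" using s by (simp add: power2_eq_square)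
    finally have "d\<^sup>2 / s \<le> 0" by (simp add: power2_eq_square)
    then show False using s ne by (simp add: d_def divide_le_0_iff)
  qed
  \<comment> \<open>Multiplying \<open>x\<close> by the imaginary unit turns real parts into
    negatives of imaginary parts.\<close>
  have "\<phi> x = ip V x y" if x: "x \<in> carrier V" for x
    using Re[OF x] Re[of "\<i> \<odot>\<^bsub>V\<^esub> x"] x y by (simp add: complex_eq_iff scale ip_simps)
  then show ?thesis using that y by blast
qed

end

section \<open>Linear maps\<close>

text \<open>Unlike \<open>linear_maps\<close>, this demands nothing outside the carrier, so
  compositions and maps written as abstractions are covered without \<open>restrict\<close>.\<close>

definition linear_on :: "'a inner_space \<Rightarrow> 'b inner_space \<Rightarrow> ('a \<Rightarrow> 'b) \<Rightarrow> bool" where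
  "linear_on V W T \<longleftrightarrow> (\<forall>x\<in>carrier V. T x \<in> carrier W) \<and>
    (\<forall>x\<in>carrier V. \<forall>y\<in>carrier V. T (x \<oplus>\<^bsub>V\<^esub> y) = T x \<oplus>\<^bsub>W\<^esub> T y) \<and>
    (\<forall>c. \<forall>x\<in>carrier V. T (c \<odot>\<^bsub>V\<^esub> x) = c \<odot>\<^bsub>W\<^esub> T x)"

lemma linear_onI:
  assumes "\<And>x. x \<in> carrier V \<Longrightarrow> T x \<in> carrier W"
    and "\<And>x y. \<lbrakk>x \<in> carrier V; y \<in> carrier V\<rbrakk> \<Longrightarrow> T (x \<oplus>\<^bsub>V\<^esub> y) = T x \<oplus>\<^bsub>W\<^esub> T y"
    and "\<And>c x. x \<in> carrier V \<Longrightarrow> T (c \<odot>\<^bsub>V\<^esub> x) = c \<odot>\<^bsub>W\<^esub> T x"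
  shows "linear_on V W T"
  using assms by (simp add: linear_on_def)

lemma linear_onD:
  assumes "linear_on V W T" "x \<in> carrier V"
  shows "T x \<in> carrier W" "T (c \<odot>\<^bsub>V\<^esub> x) = c \<odot>\<^bsub>W\<^esub> T x"
    "y \<in> carrier V \<Longrightarrow> T (x \<oplus>\<^bsub>V\<^esub> y) = T x \<oplus>\<^bsub>W\<^esub> T y"
  using assms by (simp_all add: linear_on_def)

lemma linear_maps_iff: "T \<in> linear_maps V W \<longleftrightarrow> T \<in> extensional (carrier V) \<and> linear_on V W T"
  by (auto simp: linear_maps_def linear_on_def PiE_def)

lemma restrict_linear_maps:
  assumes "complex_inner_space V" "linear_on V W T"
  shows "restrict T (carrier V) \<in> linear_maps V W"
proof -
  interpret complex_inner_space V by fact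
  show ?thesis using assms(2) by (simp add: linear_maps_iff linear_on_def)
qed

lemma linear_on_compose:
  assumes "linear_on V W T" "linear_on W Z R"
  shows "linear_on V Z (\<lambda>x. R (T x))"
  using assms by (simp add: linear_on_def)

locale inner_space_pair = V: complex_inner_space V + W: complex_inner_space W
  for V :: "'a inner_space" and W :: "'b inner_space"
begin

lemma linear_on_zero: "linear_on V W T \<Longrightarrow> T \<zero>\<^bsub>V\<^esub> = \<zero>\<^bsub>W\<^esub>"
  using linear_onD(1)[of V W T "\<zero>\<^bsub>V\<^esub>"] linear_onD(2)[of V W T "\<zero>\<^bsub>V\<^esub>" 0] by simp

lemma linear_on_diff:
  assumes "linear_on V W T" "x \<in> carrier V" "y \<in> carrier V"
  shows "T (x \<ominus>\<^bsub>V\<^esub> y) = T x \<ominus>\<^bsub>W\<^esub> T y"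
  using assms by (simp add: linear_onD V.diff_eq_smult W.diff_eq_smult)

lemma linear_on_dist_le:
  assumes "linear_on V W T" "\<And>x. x \<in> carrier V \<Longrightarrow> ip_norm W (T x) \<le> b * ip_norm V x"
    and "x \<in> carrier V" "y \<in> carrier V"
  shows "ip_dist W (T x) (T y) \<le> b * ip_dist V x y"
  using assms assms(2)[of "x \<ominus>\<^bsub>V\<^esub> y"]
  by (simp add: linear_onD V.dist_eq W.dist_eq linear_on_diff)

context
  fixes T
  assumes lin: "linear_on V W T" and norm: "\<And>x. x \<in> carrier V \<Longrightarrow> ip_norm W (T x) = ip_norm V x"
begin

text \<open>Polarization: additivity of \<open>T\<close> gives the real parts, and multiplying
  \<open>y\<close> by the imaginary unit gives the imaginary parts.\<close>

lemma isometric_ip: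
  assumes "x \<in> carrier V" "y \<in> carrier V"
  shows "ip W (T x) (T y) = ip V x y"
proof -
  have Re: "Re (ip W (T x) (T y)) = Re (ip V x y)" if "x \<in> carrier V" "y \<in> carrier V" for x y
  proof -
    have "ip_norm W (T x \<oplus>\<^bsub>W\<^esub> T y) = ip_norm V (x \<oplus>\<^bsub>V\<^esub> y)"
      using that norm[of "x \<oplus>\<^bsub>V\<^esub> y"] by (simp add: linear_onD[OF lin])
    then show ?thesis
      using that by (simp add: V.Re_ip_polar W.Re_ip_polar linear_onD[OF lin] norm)
  qed
  show ?thesis
    using assms Re[of x y] Re[of x "\<i> \<odot>\<^bsub>V\<^esub> y"]
    by (intro complex_eqI) (simp_all add: V.Im_ip_polar W.Im_ip_polar linear_onD[OF lin])
qed

lemma isometric_dist: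
  "\<lbrakk>x \<in> carrier V; y \<in> carrier V\<rbrakk> \<Longrightarrow> ip_dist W (T x) (T y) = ip_dist V x y"
  using norm[of "x \<ominus>\<^bsub>V\<^esub> y"]
  by (simp add: linear_onD[OF lin] V.dist_eq W.dist_eq linear_on_diff[OF lin])

lemma isometric_inj: "inj_on T (carrier V)"
  by (rule inj_onI) (metis V.zero W.mdist_zero isometric_dist linear_onD(1)[OF lin])

end

end

lemma (in complex_inner_space) tendsto_ip:
  assumes "(\<lambda>k. ip_dist V (f k) x) \<longlonglongrightarrow> 0" "\<And>k. f k \<in> carrier V" "x \<in> carrier V" "z \<in> carrier V"
  shows "(\<lambda>k. ip V (f k) z) \<longlonglongrightarrow> ip V x z"
proof -
  have "(\<lambda>k. ip V (f k) z - ip V x z) \<longlonglongrightarrow> 0"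
  proof (rule tendsto_0_le[OF assms(1), of _ "ip_norm V z"])
    show "\<forall>\<^sub>F k in sequentially. norm (ip V (f k) z - ip V x z) \<le> norm (ip_dist V (f k) x) * ip_norm V z"
      using norm_ip_diff_le(1)[of "f _" x z] assms(2-4) by simp
  qed
  then show ?thesis by (simp add: LIM_zero_iff)
qed

section \<open>Isometries of a Hilbert space and their adjoints\<close>

locale hilbert_isometry = H: complex_hilbert_space H
  for H :: "'a inner_space" and S +
  assumes isom: "isometry H S"
begin

sublocale HH: inner_space_pair H H ..

lemma S_lin: "linear_on H H S"
  using isom by (simp add: isometry_def linear_maps_iff)

lemma S_norm: "h \<in> carrier H \<Longrightarrow> ip_norm H (S h) = ip_norm H h"
  using isom by (simp add: isometry_def)

lemma Spow_lin: "linear_on H H (S ^^ n)"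
proof (induction n)
  case (Suc n)
  then show ?case using linear_on_compose[OF Suc S_lin] by (simp add: comp_def)
qed (simp add: linear_on_def)

lemma S_closed [simp]: "h \<in> carrier H \<Longrightarrow> S h \<in> carrier H"
  by (rule linear_onD(1)[OF S_lin])

lemma Spow_closed [simp]: "h \<in> carrier H \<Longrightarrow> (S ^^ n) h \<in> carrier H"
  by (rule linear_onD(1)[OF Spow_lin])

lemma Spow_norm: "h \<in> carrier H \<Longrightarrow> ip_norm H ((S ^^ n) h) = ip_norm H h"
  by (induction n) (simp_all add: S_norm)

text \<open>The vector \<open>x\<close> is the adjoint of \<open>S\<close> applied to
  \<open>y\<close>, obtained by Riesz representation of the functional sending \<open>z\<close> to
  \<open>ip H (S z) y\<close>. It is the term that gets prepended to a sequence in
  \<open>shift_surj\<close>.\<close>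

lemma adjoint_exists:
  assumes y: "y \<in> carrier H"
  obtains x where "x \<in> carrier H" "\<And>z. z \<in> carrier H \<Longrightarrow> ip H y (S z) = ip H x z"
proof -
  obtain x where x: "x \<in> carrier H" and eq: "\<And>z. z \<in> carrier H \<Longrightarrow> ip H (S z) y = ip H z x"
  proof (rule H.riesz_representation[where \<phi> = "\<lambda>z. ip H (S z) y" and C = "ip_norm H y"])
    show "cmod (ip H (S z) y) \<le> ip_norm H y * ip_norm H z" if "z \<in> carrier H" for z
      using H.norm_ip_le[of "S z" y] that y by (simp add: S_norm mult.commute)
  qed (use y in \<open>simp_all add: linear_onD[OF S_lin] H.ip_simps\<close>)
  have "ip H y (S z) = ip H x z" if z: "z \<in> carrier H" for z
    using eq[OF z] H.ip_commute[of "S z" y] H.ip_commute[of z x] x y z by simp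
  then show ?thesis using that x by blast
qed

end

section \<open>The universal property of the minimal unitary extension\<close>

locale minimal_extension = hilbert_isometry H S
  for H :: "'a inner_space" and S +
  fixes K :: "'b inner_space" and J U
  assumes min_ext: "minimal_unitary_extension H S K J U"
begin

sublocale K: complex_hilbert_space K
  using min_ext by (simp add: minimal_unitary_extension_def)

sublocale HK: inner_space_pair H K ..
sublocale KK: inner_space_pair K K ..

definition V where "V = inv_into (carrier K) U"

text \<open>For fixed \<open>n\<close> this parametrizes \<open>U^-n H\<close> isometrically by
  \<open>H\<close>, so every vector of the dense union has the form \<open>emb n h\<close>.\<close>

definition emb :: "nat \<Rightarrow> 'a \<Rightarrow> 'b" where "emb n h = (V ^^ n) (J h)"

lemma U_lin: "linear_on K K U"
  using min_ext by (simp add: minimal_unitary_extension_def unitary_def linear_maps_iff)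

lemma U_closed [simp]: "x \<in> carrier K \<Longrightarrow> U x \<in> carrier K"
  using linear_onD(1)[OF U_lin] .

lemma U_norm: "x \<in> carrier K \<Longrightarrow> ip_norm K (U x) = ip_norm K x"
  using min_ext by (simp add: minimal_unitary_extension_def unitary_def ip_norm_def)

lemma U_inj: "inj_on U (carrier K)"
  using KK.isometric_inj[OF U_lin U_norm] .

lemma U_surj: "U ` carrier K = carrier K"
  using min_ext by (simp add: minimal_unitary_extension_def unitary_def)

lemma V_closed [simp]: "x \<in> carrier K \<Longrightarrow> V x \<in> carrier K"
  using inv_into_into[of x U "carrier K"] by (simp add: V_def U_surj)

lemma U_V [simp]: "x \<in> carrier K \<Longrightarrow> U (V x) = x"
  by (simp add: V_def f_inv_into_f U_surj)

lemma V_U [simp]: "x \<in> carrier K \<Longrightarrow> V (U x) = x"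
  by (simp add: V_def U_inj)

lemma V_lin: "linear_on K K V"
proof (rule linear_onI)
  show "V (x \<oplus>\<^bsub>K\<^esub> y) = V x \<oplus>\<^bsub>K\<^esub> V y" if "x \<in> carrier K" "y \<in> carrier K" for x y
    by (rule inj_onD[OF U_inj]) (use that in \<open>simp_all add: linear_onD[OF U_lin]\<close>)
  show "V (c \<odot>\<^bsub>K\<^esub> x) = c \<odot>\<^bsub>K\<^esub> V x" if "x \<in> carrier K" for c x
    by (rule inj_onD[OF U_inj]) (use that in \<open>simp_all add: linear_onD[OF U_lin]\<close>)
qed simp

lemma V_norm: "x \<in> carrier K \<Longrightarrow> ip_norm K (V x) = ip_norm K x"
  using U_norm[of "V x"] by simp

lemma J_lin: "linear_on H K J"
  using min_ext by (simp add: minimal_unitary_extension_def closed_embedding_def linear_maps_iff)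

lemma J_closed [simp]: "h \<in> carrier H \<Longrightarrow> J h \<in> carrier K"
  using linear_onD(1)[OF J_lin] .

lemma J_norm: "h \<in> carrier H \<Longrightarrow> ip_norm K (J h) = ip_norm H h"
  using min_ext by (simp add: minimal_unitary_extension_def closed_embedding_def ip_norm_def)

lemma U_J: "h \<in> carrier H \<Longrightarrow> U (J h) = J (S h)"
  using min_ext by (simp add: minimal_unitary_extension_def)

lemma emb_0 [simp]: "emb 0 h = J h"
  by (simp add: emb_def)

lemma emb_lin: "linear_on H K (emb n)"
proof (induction n)
  case 0
  then show ?case using J_lin by (simp add: linear_on_def)
next
  case (Suc n)
  have "emb (Suc n) = (\<lambda>h. V (emb n h))" by (simp add: emb_def fun_eq_iff)
  then show ?case using linear_on_compose[OF Suc V_lin] by simp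
qed

lemma emb_closed [simp]: "h \<in> carrier H \<Longrightarrow> emb n h \<in> carrier K"
  using linear_onD(1)[OF emb_lin] .

lemma emb_norm: "h \<in> carrier H \<Longrightarrow> ip_norm K (emb n h) = ip_norm H h"
proof (induction n)
  case (Suc n)
  then show ?case using V_norm[of "emb n h"] emb_closed[of h n] by (simp add: emb_def)
qed (simp add: J_norm)

text \<open>Since \<open>U\<close> acts as \<open>S\<close> on the copy of \<open>H\<close>, one
  factor \<open>V\<close> cancels. Hence the images of \<open>emb n\<close> increase with
  \<open>n\<close>: \<open>h\<close> at level \<open>n\<close> is the same vector as
  \<open>S h\<close> at level \<open>n + 1\<close>.\<close>

lemma emb_Suc_S: "h \<in> carrier H \<Longrightarrow> emb (Suc n) (S h) = emb n h"
proof -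
  assume h: "h \<in> carrier H"
  have "emb (Suc n) (S h) = (V ^^ n) (V (U (J h)))"
    unfolding emb_def U_J[OF h] by (simp only: funpow_Suc_right comp_apply)
  then show ?thesis using h by (simp add: emb_def)
qed

lemma U_emb_Suc: "h \<in> carrier H \<Longrightarrow> U (emb (Suc n) h) = emb n h"
  using emb_closed[of h n] by (simp add: emb_def)

lemma U_emb: "h \<in> carrier H \<Longrightarrow> U (emb n h) = emb n (S h)"
  using U_emb_Suc[of "S h" n] by (simp add: emb_Suc_S)

lemma emb_dense:
  assumes "x \<in> carrier K" "0 < e"
  obtains n h where "h \<in> carrier H" "ip_dist K x (emb n h) < e"
proof -
  have "ip_topology K closure_of (\<Union>n. (V ^^ n) ` J ` carrier H) = carrier K"
    using min_ext by (simp add: minimal_unitary_extension_def V_def)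
  then have "\<exists>y\<in>\<Union>n. (V ^^ n) ` J ` carrier H. y \<in> K.mball x e"
    using assms unfolding K.metric_closure_of by blast
  then obtain n h where "h \<in> carrier H" "emb n h \<in> K.mball x e"
    by (auto simp: emb_def)
  then show ?thesis using that[of h n] by simp
qed

text \<open>Brings vectors given at levels \<open>n\<close> and \<open>m\<close> to the common level
  \<open>m + n\<close>.\<close>

lemma compatible_shift:
  assumes "\<And>n h. h \<in> carrier H \<Longrightarrow> F (Suc n) (S h) = F n h" and "h \<in> carrier H"
  shows "F (m + n) ((S ^^ m) h) = F n h"
  using assms(2) by (induction m) (simp_all add: assms(1))

text \<open>The density argument shared by equality of operators and the adjoint relation: taking
  \<open>y = emb n h\<close> close to \<open>x\<close> in the Lipschitz bound makes
  \<open>f x\<close> arbitrarily small.\<close>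

lemma vanishes_if_emb:
  fixes f :: "'b \<Rightarrow> real"
  assumes lip: "\<And>x y. \<lbrakk>x \<in> carrier K; y \<in> carrier K\<rbrakk> \<Longrightarrow> f x \<le> f y + b * ip_dist K x y"
    and "\<And>n h. h \<in> carrier H \<Longrightarrow> f (emb n h) = 0" and "\<And>x. x \<in> carrier K \<Longrightarrow> 0 \<le> f x"
    and x: "x \<in> carrier K"
  shows "f x = 0"
proof -
  have "f x \<le> 0 + e" if e: "0 < e" for e
  proof -
    \<comment> \<open>\<open>b\<close> may be zero or negative, whereas the tolerance
      \<open>e / b'\<close> requires a positive divisor.\<close>
    define b' where "b' = \<bar>b\<bar> + 1"
    have b': "0 < b'" "b \<le> b'" by (simp_all add: b'_def)
    obtain n h where h: "h \<in> carrier H" and d: "ip_dist K x (emb n h) < e / b'"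
      using emb_dense[OF x, of "e / b'"] e b' by (metis divide_pos_pos)
    have "f x \<le> b * ip_dist K x (emb n h)" using lip[OF x, of "emb n h"] assms(2) h by simp
    also have "\<dots> \<le> b' * ip_dist K x (emb n h)" using b' by (intro mult_right_mono) simp_all
    also have "\<dots> \<le> e" using d b' by (simp add: field_simps)
    finally show ?thesis by simp
  qed
  then show ?thesis using assms(3)[OF x] field_le_epsilon[of "f x" 0] by simp
qed

text \<open>The distance between \<open>A x\<close> and \<open>B x\<close> satisfies a Lipschitz
  bound in \<open>x\<close> with constant \<open>a + b\<close>, so \<open>vanishes_if_emb\<close>
  applies to it.\<close>

lemma eq_if_eq_emb:
  assumes "complex_inner_space L"
    and "linear_on K L A" "\<And>x. x \<in> carrier K \<Longrightarrow> ip_norm L (A x) \<le> a * ip_norm K x"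
    and "linear_on K L B" "\<And>x. x \<in> carrier K \<Longrightarrow> ip_norm L (B x) \<le> b * ip_norm K x"
    and eq: "\<And>n h. h \<in> carrier H \<Longrightarrow> A (emb n h) = B (emb n h)" and x: "x \<in> carrier K"
  shows "A x = B x"
proof -
  interpret L: complex_inner_space L by fact
  interpret KL: inner_space_pair K L ..
  note [simp] = linear_onD(1)[OF assms(2)] linear_onD(1)[OF assms(4)]
  have "ip_dist L (A x) (B x) = 0"
  proof (rule vanishes_if_emb[where b = "a + b", OF _ _ _ x])
    show "ip_dist L (A x) (B x) \<le> ip_dist L (A y) (B y) + (a + b) * ip_dist K x y"
      if "x \<in> carrier K" "y \<in> carrier K" for x y
      using KL.linear_on_dist_le[OF assms(2,3) that] KL.linear_on_dist_le[OF assms(4,5) that] that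
        L.triangle[of "A x" "A y" "B x"] L.triangle'[of "A y" "B y" "B x"]
      by (simp add: algebra_simps)
  qed (use eq in simp_all)
  then show ?thesis using x by simp
qed

text \<open>Compatibility says that the \<open>F n\<close> define a single map on the dense union of
  the \<open>U^-n H\<close>. The bound, uniform in \<open>n\<close>, makes this map Lipschitz, and
  completeness of \<open>L\<close> extends it to \<open>K\<close>.\<close>

lemma extension_exists:
  assumes "complex_hilbert_space L"
    and lin: "\<And>n. linear_on H L (F n)"
    and compat: "\<And>n h. h \<in> carrier H \<Longrightarrow> F (Suc n) (S h) = F n h"
    and bound: "\<And>n h. h \<in> carrier H \<Longrightarrow> ip_norm L (F n h) \<le> b * ip_norm H h" and "0 \<le> b"
  obtains T where "T \<in> linear_maps K L" "\<And>n h. h \<in> carrier H \<Longrightarrow> T (emb n h) = F n h"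
    "\<And>x. x \<in> carrier K \<Longrightarrow> ip_norm L (T x) \<le> b * ip_norm K x"
proof -
  interpret L: complex_hilbert_space L by fact
  interpret HL: inner_space_pair H L ..
  note F_closed [simp] = linear_onD(1)[OF lin]
  have common: "\<exists>N h' k'. h' \<in> carrier H \<and> k' \<in> carrier H \<and> F n h = F N h' \<and> F m k = F N k' \<and>
      emb n h = emb N h' \<and> emb m k = emb N k'"
    if "h \<in> carrier H" "k \<in> carrier H" for n m h k
  proof (intro exI conjI)
    show "F n h = F (m + n) ((S ^^ m) h)" "emb n h = emb (m + n) ((S ^^ m) h)"
      using compatible_shift[of F, OF compat that(1)] compatible_shift[of emb, OF emb_Suc_S that(1)]
      by simp_all
    show "F m k = F (m + n) ((S ^^ n) k)" "emb m k = emb (m + n) ((S ^^ n) k)"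
      using compatible_shift[of F k n m, OF compat that(2)]
        compatible_shift[of emb k n m, OF emb_Suc_S that(2)]
      by (simp_all only: add.commute[of n m])
  qed (use that in simp_all)
  \<comment> \<open>At a common level \<open>N\<close> both distances come from one difference in
    \<open>H\<close>, on which \<open>F N\<close> is bounded by \<open>b\<close> and
    \<open>emb N\<close> is isometric. In particular \<open>F n h\<close> depends only on the vector
    \<open>emb n h\<close>.\<close>
  have F_dist: "ip_dist L (F n h) (F m k) \<le> b * ip_dist K (emb n h) (emb m k)"
    if hk: "h \<in> carrier H" "k \<in> carrier H" for n m h k
  proof -
    obtain N h' k' where *: "h' \<in> carrier H" "k' \<in> carrier H" "F n h = F N h'" "F m k = F N k'"
      "emb n h = emb N h'" "emb m k = emb N k'"
      using common[OF hk] by blast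
    then show ?thesis
      using HL.linear_on_dist_le[OF lin bound, of h' k' N]
        HK.isometric_dist[OF emb_lin emb_norm, of h' k' N] by simp
  qed
  have small: "\<exists>n h. h \<in> carrier H \<and> b * ip_dist K x (emb n h) < e"
    if x: "x \<in> carrier K" and e: "0 < e" for x e
  proof -
    \<comment> \<open>Division by \<open>b + 1\<close> covers the case \<open>b = 0\<close>.\<close>
    have "0 < e / (b + 1)" using e \<open>0 \<le> b\<close> by simp
    then obtain n h where h: "h \<in> carrier H" and d: "ip_dist K x (emb n h) < e / (b + 1)"
      using emb_dense[OF x] by metis
    have "b * ip_dist K x (emb n h) \<le> (b + 1) * ip_dist K x (emb n h)"
      by (intro mult_right_mono) simp_all
    also have "\<dots> < e" using d \<open>0 \<le> b\<close> by (simp add: field_simps)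
    finally show ?thesis using h by blast
  qed
  \<comment> \<open>\<open>ext x y\<close> expresses that \<open>y\<close> can serve as the value at
    \<open>x\<close>, by the Lipschitz estimate against every prescribed value. No approximating
    sequence is fixed, so the linearity proofs may choose their own approximants.\<close>
  define ext where "ext x y \<longleftrightarrow> y \<in> carrier L \<and>
    (\<forall>n. \<forall>h\<in>carrier H. ip_dist L y (F n h) \<le> b * ip_dist K x (emb n h))" for x y
  have "\<exists>y. ext x y" if x: "x \<in> carrier K" for x
  proof -
    have "\<exists>n h. h \<in> carrier H \<and> b * ip_dist K x (emb n h) < inverse (Suc k)" for k
      using small[OF x] by simp
    then obtain n h where h: "\<And>k. h k \<in> carrier H"
      and d: "\<And>k. b * ip_dist K x (emb (n k) (h k)) < inverse (Suc k)" by metis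
    define f where "f k = F (n k) (h k)" for k
    have f [simp]: "f k \<in> carrier L" for k using h by (simp add: f_def)
    have f_dist: "ip_dist L (f k) (F m g) \<le> inverse (Suc k) + b * ip_dist K x (emb m g)"
      if g: "g \<in> carrier H" for k m g
    proof -
      have "ip_dist L (f k) (F m g) \<le> b * ip_dist K (emb (n k) (h k)) (emb m g)"
        unfolding f_def using F_dist[OF h g] .
      also have "\<dots> \<le> b * (ip_dist K x (emb (n k) (h k)) + ip_dist K x (emb m g))"
        using K.triangle''[of "emb (n k) (h k)" x "emb m g"] x h g \<open>0 \<le> b\<close>
        by (intro mult_left_mono) simp_all
      also have "\<dots> \<le> inverse (Suc k) + b * ip_dist K x (emb m g)"
        using d[of k] by (simp add: distrib_left)
      finally show ?thesis .
    qed
    have cauchy: "\<exists>N. \<forall>j\<ge>N. \<forall>k\<ge>N. ip_dist L (f j) (f k) < e" if e: "0 < e" for e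
    proof -
      obtain N where N: "inverse (real (Suc N)) < e / 2"
        using reals_Archimedean[of "e / 2"] e by auto
      have "ip_dist L (f j) (f k) < e" if jk: "j \<ge> N" "k \<ge> N" for j k
      proof -
        have "inverse (real (Suc j)) \<le> inverse (real (Suc N))"
          "inverse (real (Suc k)) \<le> inverse (real (Suc N))" using jk by (simp_all add: field_simps)
        then show ?thesis using f_dist[OF h[of k], of j "n k"] d[of k] N unfolding f_def by linarith
      qed
      then show ?thesis by blast
    qed
    obtain y where y: "y \<in> carrier L" and lim: "(\<lambda>k. ip_dist L (f k) y) \<longlonglongrightarrow> 0"
      using L.obtain_limit[OF f cauchy] by blast
    have "ip_dist L y (F m g) \<le> b * ip_dist K x (emb m g)" if g: "g \<in> carrier H" for m g
    proof (rule LIMSEQ_le_const)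
      show "(\<lambda>k. ip_dist L (f k) y + (inverse (Suc k) + b * ip_dist K x (emb m g)))
          \<longlonglongrightarrow> b * ip_dist K x (emb m g)"
        using tendsto_add[OF lim tendsto_add[OF LIMSEQ_inverse_real_of_nat
            tendsto_const[of "b * ip_dist K x (emb m g)"]]] by (simp only: add_0)
      show "\<exists>N. \<forall>k\<ge>N. ip_dist L y (F m g)
          \<le> ip_dist L (f k) y + (inverse (Suc k) + b * ip_dist K x (emb m g))"
      proof (intro exI allI impI)
        fix k
        show "ip_dist L y (F m g) \<le> ip_dist L (f k) y + (inverse (Suc k) + b * ip_dist K x (emb m g))"
          using L.triangle''[OF y f F_closed[OF g], of m k] f_dist[OF g, of k m] by linarith
      qed
    qed
    then show ?thesis using y by (auto simp: ext_def)
  qed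
  then obtain T where T: "\<And>x. x \<in> carrier K \<Longrightarrow> ext x (T x)" by metis
  have T_closed [simp]: "T x \<in> carrier L" if "x \<in> carrier K" for x
    using T[OF that] by (simp add: ext_def)
  have T_dist: "ip_dist L (T x) (F n h) \<le> b * ip_dist K x (emb n h)"
    if "x \<in> carrier K" "h \<in> carrier H" for x n h
    using T[OF that(1)] that(2) by (simp add: ext_def)
  have T_emb: "T (emb n h) = F n h" if h: "h \<in> carrier H" for n h
    using T_dist[of "emb n h" h n] h L.nonneg[of "T (emb n h)" "F n h"]
      L.zero[of "T (emb n h)" "F n h"] by simp
  have T_add: "T (x \<oplus>\<^bsub>K\<^esub> y) = T x \<oplus>\<^bsub>L\<^esub> T y" if x: "x \<in> carrier K" and y: "y \<in> carrier K" for x y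
  proof (rule L.dist_eqI)
    fix e :: real assume e: "0 < e"
    obtain n h where h: "h \<in> carrier H" and hd: "b * ip_dist K x (emb n h) < e / 4"
      using small[OF x, of "e / 4"] e by auto
    obtain m k where k: "k \<in> carrier H" and kd: "b * ip_dist K y (emb m k) < e / 4"
      using small[OF y, of "e / 4"] e by auto
    \<comment> \<open>Additivity is available only within a single \<open>F N\<close>, so both
      approximants are moved to a common level before being added.\<close>
    obtain N h' k' where *: "h' \<in> carrier H" "k' \<in> carrier H" "F n h = F N h'" "F m k = F N k'"
      "emb n h = emb N h'" "emb m k = emb N k'"
      using common[OF h k] by blast
    define g where "g = h' \<oplus>\<^bsub>H\<^esub> k'"
    have g: "g \<in> carrier H" "F N g = F n h \<oplus>\<^bsub>L\<^esub> F m k" "emb N g = emb n h \<oplus>\<^bsub>K\<^esub> emb m k"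
      using * by (simp_all add: g_def linear_onD[OF lin] linear_onD[OF emb_lin])
    have "ip_dist L (T (x \<oplus>\<^bsub>K\<^esub> y)) (F N g) \<le> b * ip_dist K (x \<oplus>\<^bsub>K\<^esub> y) (emb N g)"
      by (intro T_dist) (use x y g in simp_all)
    also have "\<dots> \<le> b * (ip_dist K x (emb n h) + ip_dist K y (emb m k))"
      using K.dist_add_le[of x "emb n h" y "emb m k"] x y h k g \<open>0 \<le> b\<close>
      by (intro mult_left_mono) simp_all
    finally have 1: "ip_dist L (T (x \<oplus>\<^bsub>K\<^esub> y)) (F N g) \<le> e / 2"
      using hd kd by (simp add: distrib_left)
    have "ip_dist L (T x \<oplus>\<^bsub>L\<^esub> T y) (F N g) \<le> ip_dist L (T x) (F n h) + ip_dist L (T y) (F m k)"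
      using L.dist_add_le[of "T x" "F n h" "T y" "F m k"] x y h k g by simp
    also have "\<dots> \<le> e / 2" using T_dist[OF x h, of n] T_dist[OF y k, of m] hd kd by simp
    finally have 2: "ip_dist L (T x \<oplus>\<^bsub>L\<^esub> T y) (F N g) \<le> e / 2" .
    show "ip_dist L (T (x \<oplus>\<^bsub>K\<^esub> y)) (T x \<oplus>\<^bsub>L\<^esub> T y) \<le> e"
      using L.triangle'[of "T (x \<oplus>\<^bsub>K\<^esub> y)" "F N g" "T x \<oplus>\<^bsub>L\<^esub> T y"] x y g(1) 1 2 by simp
  qed (use x y in simp_all)
  have T_smult: "T (c \<odot>\<^bsub>K\<^esub> x) = c \<odot>\<^bsub>L\<^esub> T x" if x: "x \<in> carrier K" for c x
  proof (rule L.dist_eqI)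
    fix e :: real assume e: "0 < e"
    have pos: "0 < cmod c + 1" by (simp add: add_nonneg_pos)
    obtain n h where h: "h \<in> carrier H" and hd: "b * ip_dist K x (emb n h) < e / 2 / (cmod c + 1)"
      using small[OF x, of "e / 2 / (cmod c + 1)"] e pos by auto
    have bd0: "0 \<le> b * ip_dist K x (emb n h)" using \<open>0 \<le> b\<close> by simp
    have "cmod c * (b * ip_dist K x (emb n h)) \<le> (cmod c + 1) * (b * ip_dist K x (emb n h))"
      using bd0 by (intro mult_right_mono) simp_all
    also have "\<dots> \<le> e / 2" using hd pos by (simp add: field_simps)
    finally have 0: "cmod c * (b * ip_dist K x (emb n h)) \<le> e / 2" .
    have g: "F n (c \<odot>\<^bsub>H\<^esub> h) = c \<odot>\<^bsub>L\<^esub> F n h" "emb n (c \<odot>\<^bsub>H\<^esub> h) = c \<odot>\<^bsub>K\<^esub> emb n h"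
      using h by (simp_all add: linear_onD[OF lin] linear_onD[OF emb_lin])
    have 1: "ip_dist L (T (c \<odot>\<^bsub>K\<^esub> x)) (c \<odot>\<^bsub>L\<^esub> F n h) \<le> e / 2"
      using T_dist[of "c \<odot>\<^bsub>K\<^esub> x" "c \<odot>\<^bsub>H\<^esub> h" n] K.dist_smult[of x "emb n h" c] x h g 0
      by (simp add: mult_ac)
    have "ip_dist L (c \<odot>\<^bsub>L\<^esub> T x) (c \<odot>\<^bsub>L\<^esub> F n h) \<le> cmod c * (b * ip_dist K x (emb n h))"
      using L.dist_smult[of "T x" "F n h" c] T_dist[OF x h, of n] x h by (simp add: mult_left_mono)
    then have 2: "ip_dist L (c \<odot>\<^bsub>L\<^esub> T x) (c \<odot>\<^bsub>L\<^esub> F n h) \<le> e / 2" using 0 by simp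
    show "ip_dist L (T (c \<odot>\<^bsub>K\<^esub> x)) (c \<odot>\<^bsub>L\<^esub> T x) \<le> e"
      using L.triangle'[of "T (c \<odot>\<^bsub>K\<^esub> x)" "c \<odot>\<^bsub>L\<^esub> F n h" "c \<odot>\<^bsub>L\<^esub> T x"] x h 1 2 by simp
  qed (use x in simp_all)
  have T_norm: "ip_norm L (T x) \<le> b * ip_norm K x" if x: "x \<in> carrier K" for x
    using T_dist[OF x, of "\<zero>\<^bsub>H\<^esub>" 0] x
    by (simp add: HL.linear_on_zero[OF lin] HK.linear_on_zero[OF J_lin])
  show ?thesis
  proof
    show "restrict T (carrier K) \<in> linear_maps K L"
      using T_add T_smult by (intro restrict_linear_maps linear_onI) (simp_all add: K.complex_inner_space_axioms)
    show "restrict T (carrier K) (emb n h) = F n h" if "h \<in> carrier H" for n h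
      using that by (simp add: T_emb)
    show "ip_norm L (restrict T (carrier K) x) \<le> b * ip_norm K x" if "x \<in> carrier K" for x
      using that by (simp add: T_norm)
  qed
qed

end

text \<open>\<open>W\<close> sends \<open>E.emb n h\<close> to \<open>E'.emb n h\<close> and
  \<open>W'\<close> goes back, both being contractions from \<open>extension_exists\<close>. Their
  compositions fix the embedded vectors, hence are identities, so \<open>W\<close> is an isometric
  bijection. The intertwining relation is also checked on embedded vectors.\<close>

lemma minimal_unitary_extension_unique:
  assumes "complex_hilbert_space H" "isometry H S"
    and "minimal_unitary_extension H S K J U" "minimal_unitary_extension H S K' J' U'"
  shows "\<exists>W. unitary K K' W \<and> (\<forall>x\<in>carrier H. W (J x) = J' x) \<and> (\<forall>x\<in>carrier K. W (U x) = U' (W x))"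
proof -
  interpret E: minimal_extension H S K J U
    using assms by (simp add: minimal_extension_def minimal_extension_axioms_def
        hilbert_isometry_def hilbert_isometry_axioms_def)
  interpret E': minimal_extension H S K' J' U'
    using assms by (simp add: minimal_extension_def minimal_extension_axioms_def
        hilbert_isometry_def hilbert_isometry_axioms_def)
  interpret P: inner_space_pair K K' ..
  obtain W where W: "W \<in> linear_maps K K'" and W_emb: "\<And>n h. h \<in> carrier H \<Longrightarrow> W (E.emb n h) = E'.emb n h"
    and W_norm: "\<And>x. x \<in> carrier K \<Longrightarrow> ip_norm K' (W x) \<le> 1 * ip_norm K x"
    by (rule E.extension_exists[where F = E'.emb and L = K' and b = 1])
      (simp_all add: E'.K.complex_hilbert_space_axioms E'.emb_lin E'.emb_Suc_S E'.emb_norm)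
  obtain W' where W': "W' \<in> linear_maps K' K"
    and W'_emb: "\<And>n h. h \<in> carrier H \<Longrightarrow> W' (E'.emb n h) = E.emb n h"
    and W'_norm: "\<And>x. x \<in> carrier K' \<Longrightarrow> ip_norm K (W' x) \<le> 1 * ip_norm K' x"
    by (rule E'.extension_exists[where F = E.emb and L = K and b = 1])
      (simp_all add: E.K.complex_hilbert_space_axioms E.emb_lin E.emb_Suc_S E.emb_norm)
  note W_lin = W[unfolded linear_maps_iff, THEN conjunct2]
    and W'_lin = W'[unfolded linear_maps_iff, THEN conjunct2]
  have [simp]: "W x \<in> carrier K'" if "x \<in> carrier K" for x using linear_onD(1)[OF W_lin that] .
  have [simp]: "W' x \<in> carrier K" if "x \<in> carrier K'" for x using linear_onD(1)[OF W'_lin that] .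
  have W_norm2: "ip_norm K' (W x) \<le> ip_norm K x" if "x \<in> carrier K" for x
    using W_norm[OF that] by simp
  have W'_norm2: "ip_norm K (W' x) \<le> ip_norm K' x" if "x \<in> carrier K'" for x
    using W'_norm[OF that] by simp
  have id: "linear_on Z Z (\<lambda>x. x)" for Z :: "'z inner_space" by (simp add: linear_on_def)
  have W'W: "W' (W x) = x" if "x \<in> carrier K" for x
    by (rule E.eq_if_eq_emb[OF E.K.complex_inner_space_axioms
          linear_on_compose[OF W_lin W'_lin] _ id, where a = 1 and b = 1])
      (use that in \<open>simp_all add: W_emb W'_emb order_trans[OF W'_norm2 W_norm2]\<close>)
  have WW': "W (W' x) = x" if "x \<in> carrier K'" for x
    by (rule E'.eq_if_eq_emb[OF E'.K.complex_inner_space_axioms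
          linear_on_compose[OF W'_lin W_lin] _ id, where a = 1 and b = 1])
      (use that in \<open>simp_all add: W_emb W'_emb order_trans[OF W_norm2 W'_norm2]\<close>)
  have W_isom: "ip_norm K' (W x) = ip_norm K x" if "x \<in> carrier K" for x
    using W_norm2[OF that] W'_norm2[of "W x"] that by (simp add: W'W)
  have "unitary K K' W"
    unfolding unitary_def
  proof (intro conjI ballI)
    show "W ` carrier K = carrier K'"
    proof (intro subset_antisym subsetI)
      show "y \<in> W ` carrier K" if "y \<in> carrier K'" for y
        by (rule image_eqI[of _ _ "W' y"]) (use that in \<open>simp_all add: WW'\<close>)
    qed auto
    show "ip K' (W x) (W y) = ip K x y" if "x \<in> carrier K" "y \<in> carrier K" for x y
      using P.isometric_ip[OF W_lin W_isom that] .
  qed fact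
  moreover have "W (J h) = J' h" if "h \<in> carrier H" for h
    using W_emb[OF that, of 0] by simp
  moreover have "W (U x) = U' (W x)" if "x \<in> carrier K" for x
    by (rule E.eq_if_eq_emb[OF E'.K.complex_inner_space_axioms
          linear_on_compose[OF E.U_lin W_lin] _ linear_on_compose[OF W_lin E'.U_lin], where a = 1 and b = 1])
      (use that in \<open>simp_all add: W_isom E.U_norm E'.U_norm W_emb E.U_emb E'.U_emb\<close>)
  ultimately show ?thesis by blast
qed

section \<open>Existence of the minimal unitary extension\<close>

locale isometry_extension = hilbert_isometry
begin

text \<open>The condition on the inner products says \<open>S\<^sup>* (f (n + 1)) = f n\<close>.\<close>

definition ext_carrier :: "(nat \<Rightarrow> 'a) set" where
  "ext_carrier = {f. (\<forall>n. f n \<in> carrier H) \<and>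
    (\<forall>n. \<forall>z\<in>carrier H. ip H (f (Suc n)) (S z) = ip H (f n) z) \<and> (\<exists>b. \<forall>n. ip_norm H (f n) \<le> b)}"

definition ext :: "(nat \<Rightarrow> 'a) inner_space" where
  "ext = \<lparr>carrier = ext_carrier, mult = undefined, one = undefined, zero = (\<lambda>n. \<zero>\<^bsub>H\<^esub>),
    add = (\<lambda>f g n. f n \<oplus>\<^bsub>H\<^esub> g n), smult = (\<lambda>c f n. c \<odot>\<^bsub>H\<^esub> f n),
    ip = (\<lambda>f g. lim (\<lambda>n. ip H (f n) (g n)))\<rparr>"

lemma ext_simps [simp]:
  "carrier ext = ext_carrier" "\<zero>\<^bsub>ext\<^esub> = (\<lambda>n. \<zero>\<^bsub>H\<^esub>)" "f \<oplus>\<^bsub>ext\<^esub> g = (\<lambda>n. f n \<oplus>\<^bsub>H\<^esub> g n)"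
  "c \<odot>\<^bsub>ext\<^esub> f = (\<lambda>n. c \<odot>\<^bsub>H\<^esub> f n)"
  by (simp_all add: ext_def)

lemma ext_carrierI:
  assumes "\<And>n. f n \<in> carrier H" "\<And>n z. z \<in> carrier H \<Longrightarrow> ip H (f (Suc n)) (S z) = ip H (f n) z"
    "\<And>n. ip_norm H (f n) \<le> b"
  shows "f \<in> ext_carrier"
  using assms by (auto simp: ext_carrier_def)

lemma ext_carrierD:
  assumes "f \<in> ext_carrier"
  shows "f n \<in> carrier H" "z \<in> carrier H \<Longrightarrow> ip H (f (Suc n)) (S z) = ip H (f n) z"
  using assms by (simp_all add: ext_carrier_def)

lemma ext_bounded:
  assumes "f \<in> ext_carrier"
  obtains b where "\<And>n. ip_norm H (f n) \<le> b"
  using assms by (auto simp: ext_carrier_def)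

declare ext_carrierD(1) [simp]

section \<open>The sequence space and its limit inner product\<close>

lemma ext_add_closed: "\<lbrakk>f \<in> ext_carrier; g \<in> ext_carrier\<rbrakk> \<Longrightarrow> (\<lambda>n. f n \<oplus>\<^bsub>H\<^esub> g n) \<in> ext_carrier"
proof -
  assume f: "f \<in> ext_carrier" and g: "g \<in> ext_carrier"
  obtain a b where ab: "\<And>n. ip_norm H (f n) \<le> a" "\<And>n. ip_norm H (g n) \<le> b"
    using ext_bounded[OF f] ext_bounded[OF g] by metis
  show ?thesis
  proof (rule ext_carrierI[where b = "a + b"])
    show "ip_norm H (f n \<oplus>\<^bsub>H\<^esub> g n) \<le> a + b" for n
      using H.ip_norm_triangle[OF ext_carrierD(1)[OF f] ext_carrierD(1)[OF g], of n n] ab[of n] by linarith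
  qed (use f g in \<open>simp_all add: H.ip_add_left ext_carrierD(2)\<close>)
qed

lemma ext_smult_closed: "f \<in> ext_carrier \<Longrightarrow> (\<lambda>n. c \<odot>\<^bsub>H\<^esub> f n) \<in> ext_carrier"
proof -
  assume f: "f \<in> ext_carrier"
  obtain b where b: "\<And>n. ip_norm H (f n) \<le> b" using ext_bounded[OF f] by metis
  show ?thesis
    by (rule ext_carrierI[where b = "cmod c * b"])
      (use f b in \<open>simp_all add: H.ip_smult_left ext_carrierD(2) H.norm_smult mult_left_mono\<close>)
qed

lemma ext_zero_closed: "(\<lambda>n. \<zero>\<^bsub>H\<^esub>) \<in> ext_carrier"
  by (rule ext_carrierI[where b = 0]) (simp_all add: H.ip_simps)

text \<open>The carrier condition makes \<open>f n\<close> the image of \<open>f (Suc n)\<close>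
  under the adjoint of \<open>S\<close>, which is a contraction: testing the condition at
  \<open>z = f n\<close> and applying Cauchy-Schwarz gives the inequality.\<close>

lemma ext_norm_mono:
  assumes f: "f \<in> ext_carrier"
  shows "incseq (\<lambda>n. ip_norm H (f n))"
proof (rule incseq_SucI)
  fix n
  have "(ip_norm H (f n))\<^sup>2 = Re (ip H (f (Suc n)) (S (f n)))"
    using f by (simp add: ext_carrierD(2) H.ip_norm_square)
  also have "\<dots> \<le> ip_norm H (f (Suc n)) * ip_norm H (f n)"
    using H.Re_ip_le[of "f (Suc n)" "S (f n)"] f by (simp add: S_norm)
  finally have "ip_norm H (f n) * ip_norm H (f n) \<le> ip_norm H (f (Suc n)) * ip_norm H (f n)"
    by (simp add: power2_eq_square)
  moreover have "0 \<le> ip_norm H (f n)" "0 \<le> ip_norm H (f (Suc n))" using f by simp_all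
  ultimately show "ip_norm H (f n) \<le> ip_norm H (f (Suc n))"
    by (metis mult_le_cancel_right not_less order_le_less)
qed

lemma ext_norm_convergent: "f \<in> ext_carrier \<Longrightarrow> convergent (\<lambda>n. ip_norm H (f n))"
proof -
  assume f: "f \<in> ext_carrier"
  obtain b where "\<And>n. ip_norm H (f n) \<le> b" using ext_bounded[OF f] by metis
  then obtain L where "(\<lambda>n. ip_norm H (f n)) \<longlonglongrightarrow> L"
    using incseq_convergent[OF ext_norm_mono[OF f]] by metis
  then show ?thesis by (rule convergentI)
qed

text \<open>Polarization reduces the convergence to that of norms, which are increasing and bounded.
  Thus the \<open>lim\<close> in \<open>ext\<close> is a genuine limit on the carrier.\<close>

lemma ext_ip_tendsto:
  assumes f: "f \<in> ext_carrier" and g: "g \<in> ext_carrier"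
  shows "(\<lambda>n. ip H (f n) (g n)) \<longlonglongrightarrow> ip ext f g"
proof -
  have Re: "\<exists>r. (\<lambda>n. Re (ip H (f n) (g n))) \<longlonglongrightarrow> r" if f: "f \<in> ext_carrier" and g: "g \<in> ext_carrier" for f g
  proof -
    obtain a b c where "(\<lambda>n. ip_norm H (f n)) \<longlonglongrightarrow> a" "(\<lambda>n. ip_norm H (g n)) \<longlonglongrightarrow> b"
      "(\<lambda>n. ip_norm H (f n \<oplus>\<^bsub>H\<^esub> g n)) \<longlonglongrightarrow> c"
      using ext_norm_convergent[OF f] ext_norm_convergent[OF g] ext_norm_convergent[OF ext_add_closed[OF f g]]
      unfolding convergent_def by metis
    then have "(\<lambda>n. ((ip_norm H (f n \<oplus>\<^bsub>H\<^esub> g n))\<^sup>2 - (ip_norm H (f n))\<^sup>2 - (ip_norm H (g n))\<^sup>2) / 2)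
        \<longlonglongrightarrow> (c\<^sup>2 - a\<^sup>2 - b\<^sup>2) / 2"
      by (intro tendsto_intros) simp_all
    then show ?thesis using f g by (auto simp: H.Re_ip_polar)
  qed
  obtain r where r: "(\<lambda>n. Re (ip H (f n) (g n))) \<longlonglongrightarrow> r" using Re[OF f g] by blast
  obtain i where i: "(\<lambda>n. Re (ip H (f n) (\<i> \<odot>\<^bsub>H\<^esub> g n))) \<longlonglongrightarrow> i"
    using Re[OF f ext_smult_closed[OF g, of \<i>]] by blast
  have "Re (ip H (f n) (\<i> \<odot>\<^bsub>H\<^esub> g n)) = Im (ip H (f n) (g n))" for n
    using H.Im_ip_polar[of "f n" "g n"] f g by simp
  then have "(\<lambda>n. Complex (Re (ip H (f n) (g n))) (Im (ip H (f n) (g n)))) \<longlonglongrightarrow> Complex r i"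
    using tendsto_Complex[OF r i] by simp
  then have "convergent (\<lambda>n. ip H (f n) (g n))" by (auto intro: convergentI)
  then show ?thesis by (simp add: ext_def convergent_LIMSEQ_iff)
qed

lemma ext_abelian_group: "abelian_group ext"
proof (rule abelian_groupI)
  fix f assume f: "f \<in> carrier ext"
  show "\<exists>g\<in>carrier ext. g \<oplus>\<^bsub>ext\<^esub> f = \<zero>\<^bsub>ext\<^esub>"
  proof (rule bexI)
    show "(-1) \<odot>\<^bsub>ext\<^esub> f \<oplus>\<^bsub>ext\<^esub> f = \<zero>\<^bsub>ext\<^esub>"
      using f by (simp add: H.M.l_neg flip: H.minus_eq_smult)
    show "(-1) \<odot>\<^bsub>ext\<^esub> f \<in> carrier ext" using f by (simp add: ext_smult_closed)
  qed
qed (simp_all add: ext_add_closed ext_zero_closed H.M.a_ac)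

text \<open>The module axioms hold termwise and those on the inner product pass to the limit. Strict
  positivity survives because the limit of the increasing squared norms dominates each of
  them.\<close>

lemma ext_inner_space: "complex_inner_space ext"
proof (intro complex_inner_space.intro complex_inner_space_axioms.intro moduleI ext_abelian_group)
  show "cring (ring_of_type_algebra :: complex ring)" by (rule H.R.is_cring)
  fix f g k :: "nat \<Rightarrow> 'a" and c :: complex
  assume f: "f \<in> carrier ext"
  show "0 < Re (ip ext f f)" if nz: "f \<noteq> \<zero>\<^bsub>ext\<^esub>"
  proof -
    obtain n where n: "f n \<noteq> \<zero>\<^bsub>H\<^esub>" using nz unfolding ext_simps fun_eq_iff by blast
    have "0 < Re (ip H (f n) (f n))" using H.ip_pos[OF _ n] f by simp
    also have "\<dots> \<le> Re (ip ext f f)"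
    proof (rule incseq_le)
      show "incseq (\<lambda>n. Re (ip H (f n) (f n)))"
        using f ext_norm_mono[of f] by (auto simp: incseq_def power_mono simp flip: H.ip_norm_square)
      show "(\<lambda>n. Re (ip H (f n) (f n))) \<longlonglongrightarrow> Re (ip ext f f)"
        using f by (intro tendsto_Re ext_ip_tendsto) simp_all
    qed
    finally show ?thesis .
  qed
  assume g: "g \<in> carrier ext"
  show "ip ext (c \<odot>\<^bsub>ext\<^esub> f) g = c * ip ext f g"
  proof (rule LIMSEQ_unique)
    show "(\<lambda>n. ip H ((c \<odot>\<^bsub>ext\<^esub> f) n) (g n)) \<longlonglongrightarrow> ip ext (c \<odot>\<^bsub>ext\<^esub> f) g"
      using f g by (intro ext_ip_tendsto) (simp_all add: ext_smult_closed)
    show "(\<lambda>n. ip H ((c \<odot>\<^bsub>ext\<^esub> f) n) (g n)) \<longlonglongrightarrow> c * ip ext f g"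
      using f g tendsto_mult_left[OF ext_ip_tendsto[of f g], of c] by (simp add: H.ip_smult_left)
  qed
  show "ip ext g f = cnj (ip ext f g)"
  proof (rule LIMSEQ_unique)
    show "(\<lambda>n. ip H (g n) (f n)) \<longlonglongrightarrow> ip ext g f"
      using f g by (intro ext_ip_tendsto) simp_all
    have "ip H (g n) (f n) = cnj (ip H (f n) (g n))" for n
      using f g by (intro H.ip_commute) simp_all
    then show "(\<lambda>n. ip H (g n) (f n)) \<longlonglongrightarrow> cnj (ip ext f g)"
      using f g tendsto_cnj[OF ext_ip_tendsto[of f g]] by simp
  qed
  assume k: "k \<in> carrier ext"
  show "ip ext (f \<oplus>\<^bsub>ext\<^esub> g) k = ip ext f k + ip ext g k"
  proof (rule LIMSEQ_unique)
    show "(\<lambda>n. ip H ((f \<oplus>\<^bsub>ext\<^esub> g) n) (k n)) \<longlonglongrightarrow> ip ext (f \<oplus>\<^bsub>ext\<^esub> g) k"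
      using f g k by (intro ext_ip_tendsto) (simp_all add: ext_add_closed)
    show "(\<lambda>n. ip H ((f \<oplus>\<^bsub>ext\<^esub> g) n) (k n)) \<longlonglongrightarrow> ip ext f k + ip ext g k"
      using f g k tendsto_add[OF ext_ip_tendsto[of f k] ext_ip_tendsto[of g k]]
      by (simp add: H.ip_add_left)
  qed
qed (simp_all add: ring_of_type_algebra_def ext_smult_closed H.smult_add_left H.smult_add_right)

sublocale K: complex_inner_space ext
  by (rule ext_inner_space)

lemma ext_norm_tendsto:
  assumes "f \<in> ext_carrier"
  shows "(\<lambda>n. ip_norm H (f n)) \<longlonglongrightarrow> ip_norm ext f"
  unfolding ip_norm_def using assms by (intro tendsto_intros ext_ip_tendsto)

lemma norm_le_ext_norm: "f \<in> ext_carrier \<Longrightarrow> ip_norm H (f n) \<le> ip_norm ext f"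
  by (rule incseq_le[OF ext_norm_mono ext_norm_tendsto])

lemma ext_diff:
  assumes "f \<in> ext_carrier" "g \<in> ext_carrier"
  shows "f \<ominus>\<^bsub>ext\<^esub> g = (\<lambda>n. f n \<ominus>\<^bsub>H\<^esub> g n)"
  using assms by (simp add: K.diff_eq_smult H.diff_eq_smult)

lemma ext_dist_tendsto:
  assumes "f \<in> ext_carrier" "g \<in> ext_carrier"
  shows "(\<lambda>n. ip_dist H (f n) (g n)) \<longlonglongrightarrow> ip_dist ext f g"
  using assms ext_norm_tendsto[of "f \<ominus>\<^bsub>ext\<^esub> g"] K.M.minus_closed[of f g]
  by (simp add: H.dist_eq K.dist_eq ext_diff)

lemma dist_le_ext_dist:
  assumes "f \<in> ext_carrier" "g \<in> ext_carrier"
  shows "ip_dist H (f n) (g n) \<le> ip_dist ext f g"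
  using assms norm_le_ext_norm[of "f \<ominus>\<^bsub>ext\<^esub> g" n] K.M.minus_closed[of f g]
  by (simp add: H.dist_eq K.dist_eq ext_diff)

text \<open>The norm of \<open>ext\<close> dominates the norm of every term, so the terms of a
  Cauchy sequence converge in \<open>H\<close>, uniformly in the index. The carrier condition
  survives by continuity of the inner product.\<close>

lemma ext_complete: "K.mcomplete"
  unfolding K.mcomplete_def
proof (intro allI impI)
  fix f :: "nat \<Rightarrow> nat \<Rightarrow> 'a" assume Cauchy: "K.MCauchy f"
  have f: "f k \<in> ext_carrier" for k using Cauchy unfolding K.MCauchy_def by auto
  have tail: "\<exists>N. \<forall>k\<ge>N. \<forall>m\<ge>N. ip_dist ext (f k) (f m) < e" if "0 < e" for e
    using Cauchy[unfolded K.MCauchy_def, THEN conjunct2] that by simp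
  have "\<exists>x. x \<in> carrier H \<and> (\<lambda>k. ip_dist H (f k n) x) \<longlonglongrightarrow> 0" for n
  proof -
    have "\<exists>N. \<forall>k\<ge>N. \<forall>m\<ge>N. ip_dist H (f k n) (f m n) < e" if "0 < e" for e
      using tail[OF that] dist_le_ext_dist[OF f f, of _ n] by (meson order_le_less_trans)
    then show ?thesis using H.obtain_limit[of "\<lambda>k. f k n", OF ext_carrierD(1)[OF f]] by metis
  qed
  then obtain F where F: "\<And>n. F n \<in> carrier H"
    and lim: "\<And>n. (\<lambda>k. ip_dist H (f k n) (F n)) \<longlonglongrightarrow> 0" by metis
  have unif: "\<exists>N. \<forall>k\<ge>N. \<forall>n. ip_dist H (f k n) (F n) \<le> e" if e: "0 < e" for e
  proof -
    obtain N where N: "\<forall>k\<ge>N. \<forall>m\<ge>N. ip_dist ext (f k) (f m) < e" using tail[OF e] by blast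
    \<comment> \<open>\<open>N\<close> comes from the norm of \<open>ext\<close> and hence serves
      all \<open>n\<close>; the index \<open>m\<close> of the Cauchy estimate tends to
      infinity.\<close>
    have "ip_dist H (f k n) (F n) \<le> e" if k: "k \<ge> N" for k n
    proof (rule LIMSEQ_le_const)
      show "(\<lambda>m. e + ip_dist H (f m n) (F n)) \<longlonglongrightarrow> e"
        using tendsto_add[OF tendsto_const lim[of n], of e] by (simp only: add_0_right)
      show "\<exists>M. \<forall>m\<ge>M. ip_dist H (f k n) (F n) \<le> e + ip_dist H (f m n) (F n)"
      proof (intro exI allI impI)
        fix m assume "N \<le> m"
        then have "ip_dist H (f k n) (f m n) < e"
          using N k dist_le_ext_dist[OF f f, of k n m] order_le_less_trans by blast
        then show "ip_dist H (f k n) (F n) \<le> e + ip_dist H (f m n) (F n)"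
          using H.triangle[of "f k n" "f m n" "F n"] f F by simp
      qed
    qed
    then show ?thesis by blast
  qed
  obtain N where N: "\<And>n. ip_dist H (f N n) (F n) \<le> 1" using unif[of 1] by auto
  have F_ext: "F \<in> ext_carrier"
  proof (rule ext_carrierI[OF F, where b = "ip_norm ext (f N) + 1"])
    show "ip H (F (Suc n)) (S z) = ip H (F n) z" if z: "z \<in> carrier H" for n z
    proof (rule LIMSEQ_unique)
      show "(\<lambda>k. ip H (f k n) z) \<longlonglongrightarrow> ip H (F n) z"
        by (rule H.tendsto_ip[OF lim]) (use f F z in simp_all)
      have "(\<lambda>k. ip H (f k (Suc n)) (S z)) \<longlonglongrightarrow> ip H (F (Suc n)) (S z)"
        by (rule H.tendsto_ip[OF lim]) (use f F z in simp_all)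
      then show "(\<lambda>k. ip H (f k n) z) \<longlonglongrightarrow> ip H (F (Suc n)) (S z)"
        by (simp add: ext_carrierD(2)[OF f z])
    qed
    show "ip_norm H (F n) \<le> ip_norm ext (f N) + 1" for n
      using H.norm_le_dist[OF ext_carrierD(1)[OF f] F, of N n n] N[of n] norm_le_ext_norm[OF f, of N n]
      by linarith
  qed
  have "(\<lambda>k. ip_dist ext (f k) F) \<longlonglongrightarrow> 0"
  proof (rule LIMSEQ_I)
    fix e :: real assume "0 < e"
    then obtain N where N: "\<And>k n. k \<ge> N \<Longrightarrow> ip_dist H (f k n) (F n) \<le> e / 2"
      using unif[of "e / 2"] by auto
    have "ip_dist ext (f k) F \<le> e / 2" if "k \<ge> N" for k
      by (rule LIMSEQ_le_const2[OF ext_dist_tendsto[OF f F_ext]]) (use N[OF that] in blast)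
    then have "norm (ip_dist ext (f k) F - 0) < e" if "k \<ge> N" for k
      using that \<open>0 < e\<close> K.nonneg[of "f k" F] by fastforce
    then show "\<exists>N. \<forall>k\<ge>N. norm (ip_dist ext (f k) F - 0) < e" by blast
  qed
  then show "\<exists>x. limitin (ip_topology ext) f x sequentially"
    unfolding K.limitin_metric_dist_null using F_ext f by auto
qed

sublocale K: complex_hilbert_space ext
  by (intro complex_hilbert_space.intro complex_hilbert_space_axioms.intro ext_inner_space ext_complete)

section \<open>The embedding of \<open>H\<close> and the unitary shift\<close>

definition incl where "incl = restrict (\<lambda>h n. (S ^^ n) h) (carrier H)"

definition shift :: "(nat \<Rightarrow> 'a) \<Rightarrow> nat \<Rightarrow> 'a" where
  "shift = restrict (\<lambda>f n. f (Suc n)) ext_carrier"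

text \<open>The orbit of \<open>h\<close> under \<open>S\<close> is the sequence of projections of
  \<open>U^n h = S^n h\<close> for any extension \<open>U\<close>. The carrier condition holds
  because \<open>S\<close> preserves inner products.\<close>

lemma incl_closed: "h \<in> carrier H \<Longrightarrow> (\<lambda>n. (S ^^ n) h) \<in> ext_carrier"
  by (rule ext_carrierI[where b = "ip_norm H h"])
    (simp_all add: Spow_norm HH.isometric_ip[OF S_lin S_norm])

lemma shift_closed: "f \<in> ext_carrier \<Longrightarrow> (\<lambda>n. f (Suc n)) \<in> ext_carrier"
  by (rule ext_carrierI[where b = "ip_norm ext f"]) (simp_all add: ext_carrierD(2) norm_le_ext_norm)

text \<open>The preimage prepends the only possible first term, the adjoint of \<open>S\<close>
  applied to \<open>f 0\<close>.\<close>

lemma shift_surj: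
  assumes f: "f \<in> ext_carrier"
  obtains g where "g \<in> ext_carrier" "shift g = f"
proof -
  obtain x where x: "x \<in> carrier H" and adj: "\<And>z. z \<in> carrier H \<Longrightarrow> ip H (f 0) (S z) = ip H x z"
    using adjoint_exists[of "f 0"] f by auto
  define g where "g = case_nat x f"
  have g_simps: "g 0 = x" "g (Suc n) = f n" for n by (simp_all add: g_def)
  have "g \<in> ext_carrier"
  proof (rule ext_carrierI[where b = "ip_norm H x + ip_norm ext f"])
    show "g n \<in> carrier H" for n using x f by (cases n) (simp_all add: g_simps)
    show "ip H (g (Suc n)) (S z) = ip H (g n) z" if "z \<in> carrier H" for n z
      using that f by (cases n) (simp_all add: g_simps adj ext_carrierD(2))
    show "ip_norm H (g n) \<le> ip_norm H x + ip_norm ext f" for n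
      using norm_le_ext_norm[OF f] x f K.norm_ge_0[of f]
      by (cases n) (auto simp: g_simps intro: add_increasing)
  qed
  moreover from this have "shift g = f" by (simp add: shift_def g_simps)
  ultimately show ?thesis using that by blast
qed

lemma shift_funpow_closed: "f \<in> ext_carrier \<Longrightarrow> (shift ^^ m) f \<in> ext_carrier"
  by (induction m) (simp_all add: shift_def shift_closed)

lemma shift_funpow: "f \<in> ext_carrier \<Longrightarrow> (shift ^^ m) f n = f (n + m)"
proof (induction m arbitrary: n)
  case (Suc m)
  have "shift ((shift ^^ m) f) n = (shift ^^ m) f (Suc n)"
    using shift_funpow_closed[OF Suc.prems, of m] by (simp add: shift_def)
  then show ?case using Suc by simp
qed simp

text \<open>Inner products are preserved because dropping the first term of a sequence leaves its
  limit unchanged.\<close>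

lemma unitary_shift: "unitary ext ext shift"
  unfolding unitary_def
proof (intro conjI ballI)
  show "shift \<in> linear_maps ext ext"
    using restrict_linear_maps[OF ext_inner_space, of ext "\<lambda>f n. f (Suc n)"]
    by (simp add: shift_def linear_on_def shift_closed)
  show "shift ` carrier ext = carrier ext"
  proof (intro subset_antisym subsetI)
    show "f \<in> shift ` carrier ext" if "f \<in> carrier ext" for f
      using shift_surj[of f] that by (metis ext_simps(1) imageI)
  qed (auto simp: shift_def shift_closed)
  show "ip ext (shift f) (shift g) = ip ext f g" if "f \<in> carrier ext" "g \<in> carrier ext" for f g
  proof (rule LIMSEQ_unique)
    show "(\<lambda>n. ip H (f (Suc n)) (g (Suc n))) \<longlonglongrightarrow> ip ext f g"
      using that LIMSEQ_Suc[OF ext_ip_tendsto[of f g]] by simp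
    show "(\<lambda>n. ip H (f (Suc n)) (g (Suc n))) \<longlonglongrightarrow> ip ext (shift f) (shift g)"
      using that ext_ip_tendsto[OF shift_closed shift_closed, of f g] by (simp add: shift_def)
  qed
qed

text \<open>The image of \<open>incl\<close> consists of the \<open>f\<close> with
  \<open>f n = (S ^^ n) (f 0)\<close> for all \<open>n\<close>. This is stable under limits, since
  the norm of \<open>ext\<close> controls every term.\<close>

lemma closed_embedding_incl: "closed_embedding H ext incl"
  unfolding closed_embedding_def
proof (intro conjI ballI)
  show "incl \<in> linear_maps H ext"
    using restrict_linear_maps[OF H.complex_inner_space_axioms, of ext "\<lambda>h n. (S ^^ n) h"]
    by (simp add: incl_def linear_on_def incl_closed linear_onD[OF Spow_lin])
  show "ip ext (incl x) (incl y) = ip H x y" if "x \<in> carrier H" "y \<in> carrier H" for x y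
  proof (rule LIMSEQ_unique)
    show "(\<lambda>n. ip H ((S ^^ n) x) ((S ^^ n) y)) \<longlonglongrightarrow> ip ext (incl x) (incl y)"
      using that ext_ip_tendsto[OF incl_closed incl_closed, of x y] by (simp add: incl_def)
    show "(\<lambda>n. ip H ((S ^^ n) x) ((S ^^ n) y)) \<longlonglongrightarrow> ip H x y"
      using that by (simp add: HH.isometric_ip[OF Spow_lin Spow_norm])
  qed
  have sub: "incl ` carrier H \<subseteq> ext_carrier" by (auto simp: incl_def incl_closed)
  have "ip_topology ext closure_of (incl ` carrier H) \<subseteq> incl ` carrier H"
  proof
    fix f assume "f \<in> ip_topology ext closure_of (incl ` carrier H)"
    then have f: "f \<in> ext_carrier"
      and near: "\<And>r. 0 < r \<Longrightarrow> \<exists>h\<in>carrier H. ip_dist ext f (incl h) < r"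
      unfolding K.metric_closure_of K.in_mball by auto
    have orbit: "(S ^^ n) (f 0) = f n" for n
    proof (rule H.dist_eqI)
      fix e :: real assume "0 < e"
      then obtain h where h: "h \<in> carrier H" and d: "ip_dist ext f (incl h) < e / 2"
        using near[of "e / 2"] by auto
      have close: "ip_dist H (f m) ((S ^^ m) h) < e / 2" for m
        using dist_le_ext_dist[OF f incl_closed[OF h], of m] d h by (simp add: incl_def)
      have "ip_dist H ((S ^^ n) (f 0)) ((S ^^ n) h) < e / 2"
        using close[of 0] h f by (simp add: HH.isometric_dist[OF Spow_lin Spow_norm])
      then show "ip_dist H ((S ^^ n) (f 0)) (f n) \<le> e"
        using close[of n] H.triangle'[of "(S ^^ n) (f 0)" "(S ^^ n) h" "f n"] f h by simp
    qed (use f in simp_all)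
    show "f \<in> incl ` carrier H"
      by (rule image_eqI[of _ _ "f 0"]) (use f in \<open>simp_all add: incl_def orbit\<close>)
  qed
  then show "closedin (ip_topology ext) (incl ` carrier H)"
    using sub closure_of_subset_eq[of "incl ` carrier H" "ip_topology ext"]
    unfolding K.topspace_mtopology by simp
qed

lemma ip_shift: "\<lbrakk>f \<in> ext_carrier; z \<in> carrier H\<rbrakk> \<Longrightarrow> ip H (f (m + n)) ((S ^^ m) z) = ip H (f n) z"
  by (induction m arbitrary: z) (simp_all add: ext_carrierD(2))

text \<open>The vector of \<open>U\<^sup>-\<^sup>n H\<close> approximating \<open>f\<close> is \<open>U\<^sup>-\<^sup>n (f n)\<close>; its squared distance from \<open>f\<close>
  is \<open>\<parallel>f\<parallel>\<^sup>2 - \<parallel>f n\<parallel>\<^sup>2\<close>.\<close>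

lemma minimal_unitary_extension_ext: "minimal_unitary_extension H S ext incl shift"
  unfolding minimal_unitary_extension_def
proof (intro conjI ballI)
  show "complex_hilbert_space ext" by (rule K.complex_hilbert_space_axioms)
  show "closed_embedding H ext incl" by (rule closed_embedding_incl)
  show "unitary ext ext shift" by (rule unitary_shift)
  show "shift (incl x) = incl (S x)" if "x \<in> carrier H" for x
    using that by (simp add: shift_def incl_def incl_closed funpow_swap1)
  define V where "V = inv_into (carrier ext) shift"
  have surj: "shift ` carrier ext = carrier ext" using unitary_shift by (simp add: unitary_def)
  have V: "V f \<in> ext_carrier" "shift (V f) = f" if "f \<in> ext_carrier" for f
    using that inv_into_into[of f shift "carrier ext"] f_inv_into_f[of f shift "carrier ext"] surj
    by (simp_all add: V_def)
  have Vpow: "(V ^^ n) f \<in> ext_carrier \<and> (shift ^^ n) ((V ^^ n) f) = f" if "f \<in> ext_carrier" for n f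
    using that
  proof (induction n arbitrary: f)
    case (Suc n)
    have "(shift ^^ Suc n) ((V ^^ Suc n) f) = (shift ^^ n) (shift (V ((V ^^ n) f)))"
      by (simp add: funpow_swap1)
    then show ?case using Suc.IH[OF Suc.prems] V by simp
  qed simp
  have dense: "\<exists>y\<in>\<Union>n. (V ^^ n) ` incl ` carrier H. y \<in> K.mball f r"
    if f: "f \<in> ext_carrier" and r: "0 < r" for f r
  proof -
    have "(\<lambda>n. (ip_norm ext f)\<^sup>2 - (ip_norm H (f n))\<^sup>2) \<longlonglongrightarrow> (ip_norm ext f)\<^sup>2 - (ip_norm ext f)\<^sup>2"
      by (intro tendsto_intros ext_norm_tendsto f)
    then have "\<forall>\<^sub>F n in sequentially. (ip_norm ext f)\<^sup>2 - (ip_norm H (f n))\<^sup>2 < r\<^sup>2"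
      using order_tendstoD(2)[of _ 0 sequentially "r\<^sup>2"] r by simp
    then obtain n where n: "(ip_norm ext f)\<^sup>2 - (ip_norm H (f n))\<^sup>2 < r\<^sup>2"
      by (auto dest: eventually_happens)
    have fn: "f n \<in> carrier H" using f by simp
    define x where "x = (V ^^ n) (incl (f n))"
    have incl_fn: "incl (f n) \<in> ext_carrier" using incl_closed[OF fn] fn by (simp add: incl_def)
    have x: "x \<in> ext_carrier" and "(shift ^^ n) x = incl (f n)"
      using Vpow[OF incl_fn, of n] by (simp_all add: x_def)
    \<comment> \<open>From index \<open>n\<close> on, \<open>x\<close> is the orbit of
      \<open>f n\<close>. Earlier terms do not affect limits, so this determines the distance of
      \<open>x\<close> from \<open>f\<close>.\<close>
    then have x_val: "x (m + n) = (S ^^ m) (f n)" for m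
      using shift_funpow[OF x, of n m] fn by (simp add: incl_def)
    have "(ip_dist H (f (m + n)) (x (m + n)))\<^sup>2 \<le> (ip_norm ext f)\<^sup>2 - (ip_norm H (f n))\<^sup>2" for m
    proof -
      \<comment> \<open>By \<open>ip_shift\<close> with \<open>z = f n\<close> the cross term is
        minus twice the squared norm of \<open>f n\<close>, while \<open>(S ^^ m) (f n)\<close>
        contributes that squared norm once.\<close>
      have "(ip_dist H (f (m + n)) (x (m + n)))\<^sup>2 = (ip_norm H (f (m + n)))\<^sup>2 - (ip_norm H (f n))\<^sup>2"
        using f fn by (simp add: x_val H.dist_square Spow_norm ip_shift H.ip_norm_square)
      then show ?thesis using norm_le_ext_norm[OF f, of "m + n"] f by (simp add: power_mono)
    qed
    moreover have "(\<lambda>m. (ip_dist H (f (m + n)) (x (m + n)))\<^sup>2) \<longlonglongrightarrow> (ip_dist ext f x)\<^sup>2"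
      using LIMSEQ_ignore_initial_segment[OF ext_dist_tendsto[OF f x], of n] by (intro tendsto_intros)
    ultimately have "(ip_dist ext f x)\<^sup>2 \<le> (ip_norm ext f)\<^sup>2 - (ip_norm H (f n))\<^sup>2"
      by (intro LIMSEQ_le_const2) auto
    then have "(ip_dist ext f x)\<^sup>2 < r\<^sup>2" using n by linarith
    then have "ip_dist ext f x < r" by (rule power2_less_imp_less) (use r in simp)
    moreover have "x \<in> (\<Union>n. (V ^^ n) ` incl ` carrier H)" using fn by (auto simp: x_def)
    ultimately show ?thesis
      unfolding K.in_mball using f x by (intro bexI[of _ x]) simp_all
  qed
  show "ip_topology ext closure_of
      (\<Union>n. (inv_into (carrier ext) shift ^^ n) ` incl ` carrier H) = carrier ext"
    unfolding V_def[symmetric] unfolding K.metric_closure_of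
    by (intro subset_antisym subsetI CollectI conjI allI impI dense) simp_all
qed

end

section \<open>Representations of C*-algebras\<close>

text \<open>The C*-identity and submultiplicativity bound the norm of an element by that of its
  star; applying this to the star as well gives equality.\<close>

lemma norm_star:
  fixes x :: "'g::cstar_algebra"
  shows "norm (star x) = norm x"
proof -
  have le: "norm y \<le> norm (star y)" for y :: 'g
  proof (cases "y = 0")
    case False
    have "norm y * norm y \<le> norm (star y) * norm y"
      using cstar_identity[of y] norm_mult_ineq[of "star y" y] by (simp add: power2_eq_square)
    then show ?thesis using False by simp
  qed simp
  show ?thesis using le[of x] le[of "star x"] by (simp add: star_star)
qed

text \<open>A non-unital square root: \<open>1 - x = (1 - y)\<^sup>2\<close> in the unitization.\<close>

lemma selfadjoint_sqrt_one_minus: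
  fixes x :: "'g::cstar_algebra"
  assumes sa: "star x = x" and "norm x < 1"
  obtains y where "star y = y" "2 *\<^sub>R y = x + y * y"
proof -
  \<comment> \<open>\<open>r\<close> is the smaller root of \<open>t^2 - 2 t + norm x\<close>, the
    scalar form of the equation for \<open>y\<close>. Hence \<open>f\<close> below maps the ball of
    radius \<open>r\<close> into itself, and \<open>r\<close> is also its contraction constant
    there.\<close>
  define r where "r = 1 - sqrt (1 - norm x)"
  have r: "0 \<le> r" "r < 1" and rr: "norm x + r * r = 2 * r"
    using \<open>norm x < 1\<close> by (simp_all add: r_def algebra_simps)
  define f where "f y = (1/2) *\<^sub>R (x + y * y)" for y
  have prod: "norm (y * z) \<le> r * norm z" "norm (z * y) \<le> r * norm z" if "norm y \<le> r" for y z :: 'g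
    using norm_mult_ineq[of y z] norm_mult_ineq[of z y] mult_right_mono[OF that norm_ge_zero[of z]]
    by (simp_all add: mult.commute)
  have "\<exists>!y\<in>cball 0 r. f y = y"
  proof (rule Banach_fix[where c = r])
    show "complete (cball (0::'g) r)" by (simp add: complete_eq_closed)
    show "cball (0::'g) r \<noteq> {}" using r by simp
    show "f ` cball 0 r \<subseteq> cball 0 r"
    proof clarify
      fix y :: 'g assume y: "y \<in> cball 0 r"
      then have "norm (x + y * y) \<le> norm x + r * r"
        using norm_triangle_ineq[of x "y * y"] prod(1)[of y y] mult_left_mono[of "norm y" r r] r by simp
      then show "f y \<in> cball 0 r" by (simp add: f_def rr)
    qed
    show "dist (f y) (f z) \<le> r * dist y z" if "y \<in> cball 0 r" "z \<in> cball 0 r" for y z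
    proof -
      \<comment> \<open>\<open>y\<close> and \<open>z\<close> need not commute, so the difference of
        squares is split asymmetrically.\<close>
      have "f y - f z = (1/2) *\<^sub>R (y * (y - z) + (y - z) * z)"
        by (simp add: f_def algebra_simps)
      moreover have "norm (y * (y - z) + (y - z) * z) \<le> r * norm (y - z) + r * norm (y - z)"
        using norm_triangle_ineq[of "y * (y - z)" "(y - z) * z"] prod(1)[of y "y - z"]
          prod(2)[of z "y - z"] that by simp
      ultimately show ?thesis by (simp add: dist_norm)
    qed
  qed (use r in simp_all)
  then obtain y where y: "norm y \<le> r" "f y = y" and uniq: "\<And>z. \<lbrakk>norm z \<le> r; f z = z\<rbrakk> \<Longrightarrow> z = y"
    unfolding mem_cball_0 by blast
  have star_scaleR: "star (t *\<^sub>R z) = t *\<^sub>R star z" for t and z :: 'g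
    using star_scaleC[of "complex_of_real t" z] by (simp add: scaleC_of_real)
  \<comment> \<open>The star of the fixed point is a fixed point in the same ball, so uniqueness
    makes \<open>y\<close> self-adjoint.\<close>
  have "f (star y) = star (f y)"
    by (simp add: f_def star_scaleR star_add star_mult sa)
  then have "star y = y" using uniq[of "star y"] y by (simp add: norm_star)
  moreover have "2 *\<^sub>R y = x + y * y"
  proof -
    have "2 *\<^sub>R f y = x + y * y" by (simp add: f_def)
    then show ?thesis using y(2) by simp
  qed
  ultimately show ?thesis using that by blast
qed

section \<open>Contractivity of star-representations\<close>

lemma star_representationD:
  assumes "star_representation V \<pi>"
  shows "linear_on V V (\<pi> a)" "\<pi> a \<in> extensional (carrier V)"
    "x \<in> carrier V \<Longrightarrow> \<pi> (a + b) x = \<pi> a x \<oplus>\<^bsub>V\<^esub> \<pi> b x"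
    "x \<in> carrier V \<Longrightarrow> \<pi> (c *\<^sub>C a) x = c \<odot>\<^bsub>V\<^esub> \<pi> a x"
    "x \<in> carrier V \<Longrightarrow> \<pi> (a * b) x = \<pi> a (\<pi> b x)"
    "\<lbrakk>x \<in> carrier V; y \<in> carrier V\<rbrakk> \<Longrightarrow> ip V (\<pi> a x) y = ip V x (\<pi> (star a) y)"
  using assms
  by (auto simp: star_representation_def bounded_operators_def linear_maps_iff is_adjoint_def)

text \<open>With \<open>1 - a\<^sup>* a = (1 - y)\<^sup>2\<close> one has \<open>\<parallel>v\<parallel>\<^sup>2 - \<parallel>\<pi> a v\<parallel>\<^sup>2 = \<parallel>v - \<pi> y v\<parallel>\<^sup>2\<close>.\<close>

lemma star_representation_contractive:
  fixes \<pi> :: "'g::cstar_algebra \<Rightarrow> 'a \<Rightarrow> 'a"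
  assumes "complex_inner_space V" and rep: "star_representation V \<pi>" and v: "v \<in> carrier V"
  shows "ip_norm V (\<pi> a v) \<le> norm a * ip_norm V v"
proof -
  interpret complex_inner_space V by fact
  note [simp] = linear_onD(1)[OF star_representationD(1)[OF rep]]
  have unit: "ip_norm V (\<pi> a v) \<le> ip_norm V v" if "norm a < 1" for a
  proof -
    define x where "x = star a * a"
    have "star x = x" by (simp add: x_def star_mult star_star)
    moreover have "norm x < 1"
      using that by (simp add: x_def cstar_identity power_less_one_iff)
    ultimately obtain y where y: "star y = y" and xy: "2 *\<^sub>R y = x + y * y"
      using selfadjoint_sqrt_one_minus by blast
    \<comment> \<open>The image of the relation \<open>xy\<close> under \<open>\<pi>\<close>;
      pairing it with \<open>v\<close> turns it into an identity between squared norms.\<close>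
    have "\<pi> x v \<oplus>\<^bsub>V\<^esub> \<pi> y (\<pi> y v) = 2 \<odot>\<^bsub>V\<^esub> \<pi> y v"
      using star_representationD(3)[OF rep v, of x "y * y"] star_representationD(4)[OF rep v, of 2 y]
        scaleC_of_real[of 2 y] xy star_representationD(5)[OF rep v, of y y] by simp
    then have "ip V v (\<pi> x v) + ip V v (\<pi> y (\<pi> y v)) = 2 * ip V v (\<pi> y v)"
      using v by (simp add: ip_smult_right flip: ip_add_right)
    moreover have "ip V v (\<pi> y (\<pi> y v)) = ip V (\<pi> y v) (\<pi> y v)"
      using star_representationD(6)[OF rep v, of "\<pi> y v" y] v by (simp add: y)
    moreover have "ip V v (\<pi> x v) = ip V (\<pi> a v) (\<pi> a v)"
      using star_representationD(6)[OF rep v, of "\<pi> a v" a] star_representationD(5)[OF rep v] v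
      by (simp add: x_def)
    ultimately have "ip V (\<pi> a v) (\<pi> a v) + ip V (\<pi> y v) (\<pi> y v) = 2 * ip V v (\<pi> y v)"
      by simp
    from arg_cong[OF this, of Re]
    have "(ip_norm V (\<pi> a v))\<^sup>2 = (ip_norm V v)\<^sup>2 - (ip_dist V v (\<pi> y v))\<^sup>2"
      using v by (simp add: ip_norm_square dist_square)
    then have "(ip_norm V (\<pi> a v))\<^sup>2 \<le> (ip_norm V v)\<^sup>2" by simp
    then show ?thesis by (rule power2_le_imp_le) (use v in simp)
  qed
  \<comment> \<open>The square root is available only for \<open>norm a < 1\<close>, so
    \<open>a\<close> is divided by an arbitrary \<open>t\<close> above its norm; afterwards
    \<open>t\<close> decreases to \<open>norm a\<close>.\<close>
  have scaled: "ip_norm V (\<pi> a v) \<le> t * ip_norm V v" if t: "norm a < t" for t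
  proof -
    have t0: "0 < t" using t norm_ge_zero[of a] by linarith
    define b where "b = complex_of_real (1 / t) *\<^sub>C a"
    have "norm b < 1" using t t0 by (simp add: b_def norm_scaleC norm_divide)
    moreover have "complex_of_real t *\<^sub>C b = a"
      using t0 scaleC_of_real[of 1 a] by (simp add: b_def scaleC_scaleC)
    then have "\<pi> a v = complex_of_real t \<odot>\<^bsub>V\<^esub> \<pi> b v"
      using star_representationD(4)[OF rep v, of "complex_of_real t" b] by simp
    ultimately show ?thesis using unit[of b] t0 v by (simp add: norm_smult)
  qed
  show ?thesis
  proof (cases "ip_norm V v = 0")
    case True
    then show ?thesis using scaled[of "norm a + 1"] by simp
  next
    case False
    then have pos: "0 < ip_norm V v" using norm_ge_0[OF v] by linarith
    have "ip_norm V (\<pi> a v) / ip_norm V v \<le> norm a"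
      by (rule dense_ge) (use scaled pos in \<open>simp add: divide_le_eq\<close>)
    then show ?thesis using pos by (simp add: divide_le_eq)
  qed
qed

lemma cstar_endomorphism_funpow:
  "cstar_endomorphism \<alpha> \<Longrightarrow> cstar_endomorphism (\<alpha> ^^ n)"
  by (induction n) (simp_all add: cstar_endomorphism_def)

text \<open>With \<open>cstar_endomorphism_funpow\<close> this makes \<open>\<pi>\<close> composed
  with any power of \<open>\<alpha>\<close> a representation, so its value at \<open>g\<close> is
  bounded by \<open>norm g\<close> for every power.\<close>

lemma star_representation_endomorphism:
  "\<lbrakk>star_representation V \<pi>; cstar_endomorphism \<alpha>\<rbrakk> \<Longrightarrow> star_representation V (\<lambda>g. \<pi> (\<alpha> g))"
  unfolding star_representation_def cstar_endomorphism_def by simp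

section \<open>Extension of a covariant representation to \<open>K\<close>\<close>

context complex_inner_space
begin

lemma linear_on_add:
  assumes A: "linear_on V V A" and B: "linear_on V V B"
  shows "linear_on V V (\<lambda>x. A x \<oplus>\<^bsub>V\<^esub> B x)"
  by (rule linear_onI) (simp_all add: linear_onD[OF A] linear_onD[OF B] smult_add_right M.a_ac)

lemma linear_on_smult:
  assumes A: "linear_on V V A"
  shows "linear_on V V (\<lambda>x. c \<odot>\<^bsub>V\<^esub> A x)"
  by (rule linear_onI) (simp_all add: linear_onD[OF A] smult_add_right mult.commute)

end

context minimal_extension
begin

text \<open>Density is used in one variable at a time, first in \<open>x\<close> with
  \<open>y\<close> embedded and then in \<open>y\<close>. A single \<open>n\<close> in the
  hypothesis suffices because two embedded vectors can be moved to a common level.\<close>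

lemma ip_eq_if_eq_emb:
  assumes A: "linear_on K K A" "\<And>x. x \<in> carrier K \<Longrightarrow> ip_norm K (A x) \<le> a * ip_norm K x"
    and B: "linear_on K K B" "\<And>x. x \<in> carrier K \<Longrightarrow> ip_norm K (B x) \<le> b * ip_norm K x"
    and eq: "\<And>n h k. \<lbrakk>h \<in> carrier H; k \<in> carrier H\<rbrakk> \<Longrightarrow>
      ip K (A (emb n h)) (emb n k) = ip K (emb n h) (B (emb n k))"
    and x: "x \<in> carrier K" and y: "y \<in> carrier K"
  shows "ip K (A x) y = ip K x (B y)"
proof -
  note [simp] = linear_onD(1)[OF A(1)] linear_onD(1)[OF B(1)]
  define f where "f x y = cmod (ip K (A x) y - ip K x (B y))" for x y
  have f0: "0 \<le> f x y" for x y by (simp add: f_def)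
  have f1: "f x y \<le> f x' y + (a * ip_norm K y + ip_norm K (B y)) * ip_dist K x x'"
    if [simp]: "x \<in> carrier K" "x' \<in> carrier K" "y \<in> carrier K" for x x' y
  proof -
    have "cmod (ip K (A x) y - ip K (A x') y) \<le> ip_dist K (A x) (A x') * ip_norm K y"
      by (rule K.norm_ip_diff_le) simp_all
    also have "\<dots> \<le> (a * ip_dist K x x') * ip_norm K y"
      by (intro mult_right_mono KK.linear_on_dist_le[OF A]) simp_all
    finally have 1: "cmod (ip K (A x) y - ip K (A x') y) \<le> (a * ip_dist K x x') * ip_norm K y" .
    have 2: "cmod (ip K x (B y) - ip K x' (B y)) \<le> ip_dist K x x' * ip_norm K (B y)"
      by (rule K.norm_ip_diff_le) simp_all
    have "f x y \<le> f x' y + cmod (ip K (A x) y - ip K (A x') y) + cmod (ip K x (B y) - ip K x' (B y))"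
      unfolding f_def by norm
    then show ?thesis using 1 2 by (simp add: algebra_simps)
  qed
  have f2: "f x y \<le> f x y' + (ip_norm K (A x) + b * ip_norm K x) * ip_dist K y y'"
    if [simp]: "x \<in> carrier K" "y' \<in> carrier K" "y \<in> carrier K" for x y y'
  proof -
    have "cmod (ip K x (B y) - ip K x (B y')) \<le> ip_dist K (B y) (B y') * ip_norm K x"
      by (rule K.norm_ip_diff_le) simp_all
    also have "\<dots> \<le> (b * ip_dist K y y') * ip_norm K x"
      by (intro mult_right_mono KK.linear_on_dist_le[OF B]) simp_all
    finally have 1: "cmod (ip K x (B y) - ip K x (B y')) \<le> (b * ip_dist K y y') * ip_norm K x" .
    have 2: "cmod (ip K (A x) y - ip K (A x) y') \<le> ip_dist K y y' * ip_norm K (A x)"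
      by (rule K.norm_ip_diff_le) simp_all
    have "f x y \<le> f x y' + cmod (ip K x (B y) - ip K x (B y')) + cmod (ip K (A x) y - ip K (A x) y')"
      unfolding f_def by norm
    then show ?thesis using 1 2 by (simp add: algebra_simps)
  qed
  have f_emb: "f (emb n h) (emb m k) = 0" if hk: "h \<in> carrier H" "k \<in> carrier H" for n m h k
  proof -
    have "emb n h = emb (m + n) ((S ^^ m) h)" "emb m k = emb (m + n) ((S ^^ n) k)"
      using compatible_shift[of emb h m n, OF emb_Suc_S hk(1)]
        compatible_shift[of emb k n m, OF emb_Suc_S hk(2)] by (simp_all add: add.commute)
    then show ?thesis using eq hk by (simp add: f_def)
  qed
  have fy: "f x (emb m k) = 0" if k: "k \<in> carrier H" for m k
    by (rule vanishes_if_emb[OF f1 _ _ x]) (use k in \<open>simp_all add: f_emb f0\<close>)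
  have "f x y = 0"
    by (rule vanishes_if_emb[OF f2 _ _ y]) (use x in \<open>simp_all add: f0 fy\<close>)
  then show ?thesis by (simp add: f_def)
qed

context
  fixes \<alpha> :: "'g::cstar_algebra \<Rightarrow> 'g" and \<pi> :: "'g \<Rightarrow> 'a \<Rightarrow> 'a"
  assumes endo: "cstar_endomorphism \<alpha>" and rep: "star_representation H \<pi>"
    and covariant: "\<And>g h. h \<in> carrier H \<Longrightarrow> S (\<pi> g h) = \<pi> (\<alpha> g) (S h)"
begin

lemma rep_closed [simp]: "h \<in> carrier H \<Longrightarrow> \<pi> g h \<in> carrier H"
  by (rule linear_onD(1)[OF star_representationD(1)[OF rep]])

text \<open>Covariance forces the values of \<open>\<rho> g\<close> on \<open>U^-n H\<close>.
  Passing \<open>U\<close> across \<open>\<rho> g\<close> replaces \<open>g\<close> by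
  \<open>\<alpha> g\<close>, so the induction runs over all \<open>g\<close>, and injectivity of
  \<open>U\<close> removes it again.\<close>

lemma covariant_extension_emb:
  assumes J: "\<And>g h. h \<in> carrier H \<Longrightarrow> \<rho> g (J h) = J (\<pi> g h)"
    and U: "\<And>g x. x \<in> carrier K \<Longrightarrow> U (\<rho> g x) = \<rho> (\<alpha> g) (U x)"
    and closed: "\<And>g x. x \<in> carrier K \<Longrightarrow> \<rho> g x \<in> carrier K"
    and h: "h \<in> carrier H"
  shows "\<rho> g (emb n h) = emb n (\<pi> ((\<alpha> ^^ n) g) h)"
proof (induction n arbitrary: g)
  case (Suc n)
  have "U (\<rho> g (emb (Suc n) h)) = \<rho> (\<alpha> g) (emb n h)"
    using U[of "emb (Suc n) h" g] h by (simp add: U_emb_Suc)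
  also have "\<dots> = U (emb (Suc n) (\<pi> ((\<alpha> ^^ Suc n) g) h))"
    using h by (simp add: Suc U_emb_Suc funpow_swap1)
  finally show ?case by (rule inj_onD[OF U_inj]) (use h in \<open>simp_all add: closed\<close>)
qed (simp add: J h)

text \<open>The forced values are taken as a prescription for \<open>extension_exists\<close>, with
  the bound \<open>norm g\<close> at every level. Each required identity is verified on embedded
  vectors, using that \<open>\<pi>\<close> composed with \<open>\<alpha> ^^ n\<close> is a
  representation, and extends to \<open>K\<close> by density.\<close>

lemma covariant_extension_exists:
  "\<exists>\<rho>. star_representation K \<rho> \<and> (\<forall>g. \<forall>h\<in>carrier H. \<rho> g (J h) = J (\<pi> g h)) \<and>
    (\<forall>g. \<forall>x\<in>carrier K. U (\<rho> g x) = \<rho> (\<alpha> g) (U x))"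
proof -
  note rep_n = star_representation_endomorphism[OF rep cstar_endomorphism_funpow[OF endo]]
  have ext: "\<exists>T. T \<in> linear_maps K K \<and> (\<forall>n. \<forall>h\<in>carrier H. T (emb n h) = emb n (\<pi> ((\<alpha> ^^ n) g) h)) \<and>
      (\<forall>x\<in>carrier K. ip_norm K (T x) \<le> norm g * ip_norm K x)" for g
  proof (rule extension_exists[where L = K and b = "norm g" and F = "\<lambda>n h. emb n (\<pi> ((\<alpha> ^^ n) g) h)"])
    show "linear_on H K (\<lambda>h. emb n (\<pi> ((\<alpha> ^^ n) g) h))" for n
      by (rule linear_on_compose[OF star_representationD(1)[OF rep] emb_lin])
    \<comment> \<open>Covariance rewrites the argument as
      \<open>S (\<pi> ((\<alpha> ^^ n) g) h)\<close>, to which \<open>emb_Suc_S\<close>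
      applies.\<close>
    show "emb (Suc n) (\<pi> ((\<alpha> ^^ Suc n) g) (S h)) = emb n (\<pi> ((\<alpha> ^^ n) g) h)"
      if "h \<in> carrier H" for n h
      using that emb_Suc_S[of "\<pi> ((\<alpha> ^^ n) g) h" n] by (simp add: covariant)
    show "ip_norm K (emb n (\<pi> ((\<alpha> ^^ n) g) h)) \<le> norm g * ip_norm H h" if "h \<in> carrier H" for n h
      using star_representation_contractive[OF H.complex_inner_space_axioms rep_n that] that
      by (simp add: emb_norm)
  qed (use K.complex_hilbert_space_axioms in auto)
  then obtain \<rho> where \<rho>: "\<And>g. \<rho> g \<in> linear_maps K K"
    and \<rho>_emb: "\<And>g n h. h \<in> carrier H \<Longrightarrow> \<rho> g (emb n h) = emb n (\<pi> ((\<alpha> ^^ n) g) h)"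
    and \<rho>_norm: "\<And>g x. x \<in> carrier K \<Longrightarrow> ip_norm K (\<rho> g x) \<le> norm g * ip_norm K x"
    by metis
  have lin: "linear_on K K (\<rho> g)" for g using \<rho>[of g] by (simp add: linear_maps_iff)
  note [simp] = linear_onD(1)[OF lin]
  have \<rho>\<rho>_norm: "ip_norm K (\<rho> g (\<rho> g' x)) \<le> (norm g * norm g') * ip_norm K x"
    if "x \<in> carrier K" for g g' x
    using \<rho>_norm[of "\<rho> g' x" g] mult_left_mono[OF \<rho>_norm[OF that, of g'] norm_ge_zero[of g]] that
    by simp
  have add: "\<rho> (g + g') x = \<rho> g x \<oplus>\<^bsub>K\<^esub> \<rho> g' x" if "x \<in> carrier K" for g g' x
  proof (rule eq_if_eq_emb[OF K.complex_inner_space_axioms lin \<rho>_norm K.linear_on_add[OF lin lin] _ _ that])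
    show "ip_norm K (\<rho> g x \<oplus>\<^bsub>K\<^esub> \<rho> g' x) \<le> (norm g + norm g') * ip_norm K x" if "x \<in> carrier K" for x
      using K.ip_norm_triangle[of "\<rho> g x" "\<rho> g' x"] \<rho>_norm[OF that, of g] \<rho>_norm[OF that, of g'] that
      by (simp add: distrib_right)
  qed (simp_all add: \<rho>_emb star_representationD(3)[OF rep_n] linear_onD[OF emb_lin])
  have scale: "\<rho> (c *\<^sub>C g) x = c \<odot>\<^bsub>K\<^esub> \<rho> g x" if "x \<in> carrier K" for c g x
  proof (rule eq_if_eq_emb[OF K.complex_inner_space_axioms lin \<rho>_norm K.linear_on_smult[OF lin] _ _ that])
    show "ip_norm K (c \<odot>\<^bsub>K\<^esub> \<rho> g x) \<le> (cmod c * norm g) * ip_norm K x" if "x \<in> carrier K" for x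
      using mult_left_mono[OF \<rho>_norm[OF that, of g] norm_ge_zero[of c]] that
      by (simp add: K.norm_smult)
  qed (simp_all add: \<rho>_emb star_representationD(4)[OF rep_n] linear_onD[OF emb_lin])
  have mult: "\<rho> (g * g') x = \<rho> g (\<rho> g' x)" if "x \<in> carrier K" for g g' x
    by (rule eq_if_eq_emb[OF K.complex_inner_space_axioms lin \<rho>_norm linear_on_compose[OF lin lin] \<rho>\<rho>_norm _ that])
      (simp_all add: \<rho>_emb star_representationD(5)[OF rep_n])
  have adj: "ip K (\<rho> g x) y = ip K x (\<rho> (star g) y)" if "x \<in> carrier K" "y \<in> carrier K" for g x y
  proof (rule ip_eq_if_eq_emb[OF lin \<rho>_norm lin \<rho>_norm _ that])
    show "ip K (\<rho> g (emb n h)) (emb n k) = ip K (emb n h) (\<rho> (star g) (emb n k))"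
      if hk: "h \<in> carrier H" "k \<in> carrier H" for n h k
      using star_representationD(6)[OF rep_n hk, of n g]
      by (simp add: \<rho>_emb hk HK.isometric_ip[OF emb_lin emb_norm])
  qed
  have cov: "U (\<rho> g x) = \<rho> (\<alpha> g) (U x)" if "x \<in> carrier K" for g x
  proof (rule eq_if_eq_emb[OF K.complex_inner_space_axioms linear_on_compose[OF lin U_lin] _
        linear_on_compose[OF U_lin lin] _ _ that])
    show "ip_norm K (U (\<rho> g x)) \<le> norm g * ip_norm K x"
      "ip_norm K (\<rho> (\<alpha> g) (U x)) \<le> norm (\<alpha> g) * ip_norm K x" if "x \<in> carrier K" for x
      using \<rho>_norm[OF that, of g] \<rho>_norm[of "U x" "\<alpha> g"] that by (simp_all add: U_norm)
    \<comment> \<open>Both sides equal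
      \<open>emb n (\<pi> ((\<alpha> ^^ Suc n) g) (S h))\<close>.\<close>
    show "U (\<rho> g (emb n h)) = \<rho> (\<alpha> g) (U (emb n h))" if "h \<in> carrier H" for n h
      using that by (simp add: \<rho>_emb U_emb covariant funpow_swap1)
  qed
  have "\<rho> g (J h) = J (\<pi> g h)" if "h \<in> carrier H" for g h
    using \<rho>_emb[OF that, of g 0] by simp
  moreover have "star_representation K \<rho>"
    unfolding star_representation_def is_adjoint_def
  proof (intro conjI allI ballI)
    show "\<rho> g \<in> bounded_operators K" for g
      unfolding bounded_operators_def using \<rho>[of g] \<rho>_norm[of _ g] by blast
  qed (simp_all add: add scale mult adj)
  ultimately show ?thesis using cov by blast
qed

text \<open>\<open>covariant_extension_emb\<close> fixes both representations on embedded vectors,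
  contractivity supplies the bounds for the density argument, and extensionality settles arguments
  outside the carrier of \<open>K\<close>.\<close>

lemma covariant_extension_unique:
  assumes "star_representation K \<rho>" "\<And>g h. h \<in> carrier H \<Longrightarrow> \<rho> g (J h) = J (\<pi> g h)"
      "\<And>g x. x \<in> carrier K \<Longrightarrow> U (\<rho> g x) = \<rho> (\<alpha> g) (U x)"
    and "star_representation K \<sigma>" "\<And>g h. h \<in> carrier H \<Longrightarrow> \<sigma> g (J h) = J (\<pi> g h)"
      "\<And>g x. x \<in> carrier K \<Longrightarrow> U (\<sigma> g x) = \<sigma> (\<alpha> g) (U x)"
  shows "\<rho> = \<sigma>"
proof (intro ext)
  fix g x
  note [simp] = linear_onD(1)[OF star_representationD(1)[OF assms(1)]]
    linear_onD(1)[OF star_representationD(1)[OF assms(4)]]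
  note contr = star_representation_contractive[OF K.complex_inner_space_axioms]
  show "\<rho> g x = \<sigma> g x"
  proof (cases "x \<in> carrier K")
    case True
    show ?thesis
    proof (rule eq_if_eq_emb[OF K.complex_inner_space_axioms star_representationD(1)[OF assms(1)]
          contr[OF assms(1)] star_representationD(1)[OF assms(4)] contr[OF assms(4)] _ True])
      show "\<rho> g (emb n h) = \<sigma> g (emb n h)" if "h \<in> carrier H" for n h
        using covariant_extension_emb[of \<rho> h g n, OF assms(2,3) _ that]
          covariant_extension_emb[of \<sigma> h g n, OF assms(5,6) _ that] by simp
    qed
  next
    case False
    then show ?thesis
      using star_representationD(2)[OF assms(1), of g] star_representationD(2)[OF assms(4), of g]
      by (simp add: extensional_def)
  qed
qed

end

end

text \<open>The existence witness lives on sequences in \<open>'a\<close>, whereas the other two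
  claims range over extensions on arbitrary types; their proofs rest on the defining properties of
  an extension and not on its construction.\<close>

theorem theorem4p2p1:
  fixes H :: "'a inner_space" and S :: "'a \<Rightarrow> 'a"
  assumes "complex_hilbert_space H" and "isometry H S"
  shows
    "(\<exists>(K :: (nat \<Rightarrow> 'a) inner_space) J U. minimal_unitary_extension H S K J U) \<and>
     (\<forall>(K :: 'b inner_space) J U (K' :: 'c inner_space) J' U'.
        minimal_unitary_extension H S K J U \<longrightarrow> minimal_unitary_extension H S K' J' U' \<longrightarrow>
        (\<exists>W. unitary K K' W \<and> (\<forall>x\<in>carrier H. W (J x) = J' x) \<and>
             (\<forall>x\<in>carrier K. W (U x) = U' (W x)))) \<and>
     (\<forall>(K :: 'b inner_space) J U (\<alpha> :: 'g::cstar_algebra \<Rightarrow> 'g) (\<pi> :: 'g \<Rightarrow> 'a \<Rightarrow> 'a).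
        minimal_unitary_extension H S K J U \<longrightarrow>
        cstar_endomorphism \<alpha> \<longrightarrow>
        star_representation H \<pi> \<longrightarrow>
        (\<forall>g. \<forall>x\<in>carrier H. S (\<pi> g x) = \<pi> (\<alpha> g) (S x)) \<longrightarrow>
        (\<exists>!\<rho> :: 'g \<Rightarrow> 'b \<Rightarrow> 'b. star_representation K \<rho> \<and>
           (\<forall>g. \<forall>x\<in>carrier H. \<rho> g (J x) = J (\<pi> g x)) \<and>
           (\<forall>g. \<forall>x\<in>carrier K. U (\<rho> g x) = \<rho> (\<alpha> g) (U x))))"
proof (intro conjI allI impI)
  interpret isometry_extension H S
    using assms by (simp add: isometry_extension_def hilbert_isometry_def hilbert_isometry_axioms_def)
  show "\<exists>(K :: (nat \<Rightarrow> 'a) inner_space) J U. minimal_unitary_extension H S K J U"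
    using minimal_unitary_extension_ext by blast
next
  fix K :: "'b inner_space" and J U and K' :: "'c inner_space" and J' U'
  assume "minimal_unitary_extension H S K J U" "minimal_unitary_extension H S K' J' U'"
  then show "\<exists>W. unitary K K' W \<and> (\<forall>x\<in>carrier H. W (J x) = J' x) \<and>
      (\<forall>x\<in>carrier K. W (U x) = U' (W x))"
    by (rule minimal_unitary_extension_unique[OF assms])
next
  fix K :: "'b inner_space" and J U and \<alpha> :: "'g \<Rightarrow> 'g" and \<pi> :: "'g \<Rightarrow> 'a \<Rightarrow> 'a"
  assume min: "minimal_unitary_extension H S K J U"
    and endo: "cstar_endomorphism \<alpha>" and rep: "star_representation H \<pi>"
    and cov: "\<forall>g. \<forall>x\<in>carrier H. S (\<pi> g x) = \<pi> (\<alpha> g) (S x)"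
  interpret minimal_extension H S K J U
    using assms min by (simp add: minimal_extension_def minimal_extension_axioms_def
        hilbert_isometry_def hilbert_isometry_axioms_def)
  have cov': "\<And>g h. h \<in> carrier H \<Longrightarrow> S (\<pi> g h) = \<pi> (\<alpha> g) (S h)" using cov by blast
  show "\<exists>!\<rho> :: 'g \<Rightarrow> 'b \<Rightarrow> 'b. star_representation K \<rho> \<and>
      (\<forall>g. \<forall>x\<in>carrier H. \<rho> g (J x) = J (\<pi> g x)) \<and>
      (\<forall>g. \<forall>x\<in>carrier K. U (\<rho> g x) = \<rho> (\<alpha> g) (U x))"
  proof (rule ex_ex1I)
    show "\<exists>\<rho> :: 'g \<Rightarrow> 'b \<Rightarrow> 'b. star_representation K \<rho> \<and>
        (\<forall>g. \<forall>x\<in>carrier H. \<rho> g (J x) = J (\<pi> g x)) \<and>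
        (\<forall>g. \<forall>x\<in>carrier K. U (\<rho> g x) = \<rho> (\<alpha> g) (U x))"
      by (rule covariant_extension_exists[OF endo rep cov'])
  next
    fix \<rho> \<sigma> :: "'g \<Rightarrow> 'b \<Rightarrow> 'b"
    assume \<rho>: "star_representation K \<rho> \<and> (\<forall>g. \<forall>x\<in>carrier H. \<rho> g (J x) = J (\<pi> g x)) \<and>
        (\<forall>g. \<forall>x\<in>carrier K. U (\<rho> g x) = \<rho> (\<alpha> g) (U x))"
      and \<sigma>: "star_representation K \<sigma> \<and> (\<forall>g. \<forall>x\<in>carrier H. \<sigma> g (J x) = J (\<pi> g x)) \<and>
        (\<forall>g. \<forall>x\<in>carrier K. U (\<sigma> g x) = \<sigma> (\<alpha> g) (U x))"
    show "\<rho> = \<sigma>"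
      by (rule covariant_extension_unique[OF endo rep cov']) (use \<rho> \<sigma> in blast)+
  qed
qed

end
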